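(* Let $R$ be a random compact set satisfying Assumption 1 of the context, let $\mathbf{R}_1,\mathbf{R}_2,\ldots$ be i.i.d. copies of it, and let $\sigma(Q,Q_0)=\rho(Q-Q_0)$ be a grid cost satisfying Assumption 2 of the context. Suppose the renewable production $Q_0=Q_{0,n}\in\mathbb{R}^d$ in the system with $n$ consumers satisfies $\lim_{n\to\infty} Q_{0,n}/n = q_0$ almost surely, for some $q_0\in\mathbb{R}^d$. Then: 1. The scaled cost of the direct control mechanism, $$\widehat{\mathsf R}_n^{\mathsf{DM}}=\min\Big\{\sigma\Big(\sum_{i=1}^n q_i,\,Q_{0,n}\Big): q_i\in \mathbf{R}_i \text{ for all } i=1,\ldots,n\Big\},$$ converges almost surely: $$\lim_{n\to\infty}\frac1n \widehat{\mathsf R}_n^{\mathsf{DM}}=\mathsf{R}^{\mathsf{DM}}:=\max\{H(z)-z\cdot q_0 : z\in\mathcal{P}\}.$$ 2. For any price $p\in\mathbb{R}^d$, if $H$ is differentiable at $p$, then the scaled grid cost from using prices $p$ converges almost surely: $$\lim_{n\to\infty}\frac1n\,\sigma\Big(\sum_{i=1}^n q_i(p),\,Q_{0,n}\Big)=\rho\big(\nabla H(p)-q_0\big).$$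
   Context: $d\ge 1$ is the number of time periods; $\mathfrak{C}_d$ is the space of non-empty compact subsets of $\mathbb{R}^d$. For $C\subset\mathbb{R}^d$, $\|C\|=\sup\{\|c\|:c\in C\}$. Random sets. Given a probability space $(\Omega,\mathcal{F},P)$, a multifunction $R:\Omega\rightrightarrows\mathbb{R}^d$ with values in $\mathfrak{C}_d$ is measurable if $\{\omega: R(\omega)\cap O\ne\emptyset\}\in\mathcal{F}$ for all open $O\subset\mathbb{R}^d$; $\mathbf{R}=R(\omega)$ is then a random set. A selection of $\mathbf{R}$ is a random vector $X$ in $\mathbb{R}^d$ on $(\Omega,\mathcal F,P)$ with $P(X\in\mathbf{R})=1$ and $\mathbb{E}\|X\|<\infty$. The expectation is $\mathbb{E}[\mathbf{R}]=\{\mathbb{E}[X]: X \text{ is a selection of }\mathbf{R}\}$. Assumption 1. The consumers' indifference sets $\mathbf{R}_1,\mathbf{R}_2,\ldots$ are i.i.d. random elements of $\mathfrak{C}_d$, with the distribution of $\mathbf{R}=R(\omega)$ for a measurable multifunction $R$ with values in $\mathfrak{C}_d$ on a non-atomic probability space $(\Omega,\mathcal{F},P)$, and $\mathbb{E}[\|\mathbf{R}\|]<\infty$. (Then $\mathbb{E}[\mathbf{R}]\in\mathfrak{C}_d$; $\mathbb{E}[\mathbf{R}_i]$ means $\mathbb{E}[\mathbf{R}]$.) Assumption 2. $\sigma(Q,Q_0)=\rho(Q-Q_0)$, where $\rho:\mathbb{R}^d\to\mathbb{R}$ is convex and positively homogeneous of order one: $\rho(\alpha q)=\alpha\rho(q)$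 for all $\alpha\ge0$, $q\in\mathbb{R}^d$. Notation. $\mathcal{P}=\{z\in\mathbb{R}^d: z\cdot q\le\rho(q)\ \forall q\in\mathbb{R}^d\}$. For non-empty compact $C$, $h(p;C)=\min\{q\cdot p: q\in C\}$. $H(p)=h(p;\mathbb{E}[\mathbf{R}])$. Given a price $p\in\mathbb{R}^d$, consumer $i$ consumes some $q_i(p)\in\arg\min\{p\cdot q: q\in\mathbf{R}_i\}$. *)

theory Defs
  imports "HOL-Probability.Probability"
begin

definition nonempty_compacts :: "'a::topological_space set set" where
  "nonempty_compacts = {C. compact C \<and> C \<noteq> {}}"

text \<open>The measurable space of non-empty compact sets, with the \<open>\<sigma>\<close>-algebra generated by the events of
  hitting an open set. It carries the laws of random compact sets.\<close>

definition compacts_algebra :: "'a::topological_space set measure" where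
  "compacts_algebra =
     sigma nonempty_compacts {{C \<in> nonempty_compacts. C \<inter> U \<noteq> {}} | U. open U}"

definition random_compact_set :: "'w measure \<Rightarrow> ('w \<Rightarrow> 'a::topological_space set) \<Rightarrow> bool" where
  "random_compact_set M R \<longleftrightarrow>
     (\<forall>\<omega>\<in>space M. R \<omega> \<in> nonempty_compacts) \<and>
     (\<forall>U. open U \<longrightarrow> {\<omega> \<in> space M. R \<omega> \<inter> U \<noteq> {}} \<in> sets M)"

lemma random_compact_set_iff_measurable:
  "random_compact_set M R \<longleftrightarrow> R \<in> measurable M compacts_algebra"
proof
  assume R: "random_compact_set M R"
  have "R -` {C \<in> nonempty_compacts. C \<inter> U \<noteq> {}} \<inter> space M = {\<omega> \<in> space M. R \<omega> \<inter> U \<noteq> {}}" for U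
    using R by (auto simp: random_compact_set_def)
  then show "R \<in> measurable M compacts_algebra"
    using R unfolding compacts_algebra_def
    by (intro measurable_measure_of) (auto simp: random_compact_set_def)
next
  assume R: "R \<in> measurable M compacts_algebra"
  have sp: "space compacts_algebra = (nonempty_compacts :: 'b set set)"
    unfolding compacts_algebra_def by (auto intro!: space_measure_of)
  have val: "R \<omega> \<in> nonempty_compacts" if "\<omega> \<in> space M" for \<omega>
    using measurable_space[OF R that] sp by simp
  have "{\<omega> \<in> space M. R \<omega> \<inter> U \<noteq> {}} \<in> sets M" if "open U" for U
  proof -
    have "{C \<in> nonempty_compacts. C \<inter> U \<noteq> {}} \<in> sets (compacts_algebra :: 'b set measure)"
      unfolding compacts_algebra_def using that
      by (subst sets_measure_of) (auto intro!: sigma_sets.Basic)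
    from measurable_sets[OF R this]
    have "R -` {C \<in> nonempty_compacts. C \<inter> U \<noteq> {}} \<inter> space M \<in> sets M" .
    also have "R -` {C \<in> nonempty_compacts. C \<inter> U \<noteq> {}} \<inter> space M = {\<omega> \<in> space M. R \<omega> \<inter> U \<noteq> {}}"
      using val by auto
    finally show ?thesis .
  qed
  then show "random_compact_set M R"
    using val by (auto simp: random_compact_set_def)
qed

definition non_atomic :: "'w measure \<Rightarrow> bool" where
  "non_atomic M \<longleftrightarrow>
     (\<forall>A\<in>sets M. emeasure M A > 0 \<longrightarrow>
        (\<exists>B\<in>sets M. B \<subseteq> A \<and> 0 < emeasure M B \<and> emeasure M B < emeasure M A))"

definition set_norm :: "'a::real_normed_vector set \<Rightarrow> real" where
  "set_norm C = (SUP c\<in>C. norm c)"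

text \<open>Integrability of a selection includes its Borel measurability.\<close>

definition selection :: "'w measure \<Rightarrow> ('w \<Rightarrow> 'a::euclidean_space set) \<Rightarrow> ('w \<Rightarrow> 'a) \<Rightarrow> bool" where
  "selection M R X \<longleftrightarrow> integrable M X \<and> (AE \<omega> in M. X \<omega> \<in> R \<omega>)"

definition set_expectation :: "'w measure \<Rightarrow> ('w \<Rightarrow> 'a::euclidean_space set) \<Rightarrow> 'a set" where
  "set_expectation M R = {integral\<^sup>L M X | X. selection M R X}"

text \<open>\<open>LEAST\<close> and \<open>GREATEST\<close> over the reals denote attained minima and maxima; they are unspecified
  when the extremum is not attained.\<close>

definition min_support :: "'a::euclidean_space \<Rightarrow> 'a set \<Rightarrow> real" where
  "min_support p C = (LEAST v. v \<in> (\<lambda>q. q \<bullet> p) ` C)"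

definition polar :: "('a::euclidean_space \<Rightarrow> real) \<Rightarrow> 'a set" where
  "polar \<rho> = {z. \<forall>q. z \<bullet> q \<le> \<rho> q}"

text \<open>Sequences are indexed from \<open>0\<close>: the consumers of the system of size \<open>n\<close> are the \<open>i < n\<close>.\<close>

definition direct_cost ::
  "('a::euclidean_space \<Rightarrow> 'a \<Rightarrow> real) \<Rightarrow> nat \<Rightarrow> (nat \<Rightarrow> 'a set) \<Rightarrow> 'a \<Rightarrow> real" where
  "direct_cost \<sigma> n S Q\<^sub>0 =
     (LEAST c. c \<in> {\<sigma> (\<Sum>i<n. q i) Q\<^sub>0 | q. \<forall>i<n. q i \<in> S i})"

definition direct_limit ::
  "('a::euclidean_space \<Rightarrow> real) \<Rightarrow> ('a \<Rightarrow> real) \<Rightarrow> 'a \<Rightarrow> real" where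
  "direct_limit \<rho> H q\<^sub>0 = (GREATEST v. v \<in> (\<lambda>z. H z - z \<bullet> q\<^sub>0) ` polar \<rho>)"

definition gradient :: "('a::euclidean_space \<Rightarrow> real) \<Rightarrow> 'a \<Rightarrow> 'a" where
  "gradient f x = (THE g. GDERIV f x :> g)"

end

theory Submission
  imports Defs
begin

text \<open>
  Everything rests on one probabilistic fact: almost surely, the empirical support functions
  \<open>H_avg n z = (\<Sum>i<n. min_support z (R\<^sub>i)) / n\<close> converge to \<open>H\<close>, uniformly on compact sets, and the
  averages of \<open>set_norm (R\<^sub>i)\<close> converge. It follows from the strong law of large numbers at countably
  many \<open>z\<close>, because \<open>H_avg n\<close> is Lipschitz with constant the average of the norms, once \<open>H z\<close> is
  recognised as the mean of \<open>min_support z R\<close>. This recognition needs a measurable selection of the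
  minimisers, which is obtained by breaking ties lexicographically along a basis. The rest
  of the argument is deterministic and runs for each fixed sample of sets.

  Direct control. A point \<open>z\<close> of the polar of \<open>\<rho>\<close> bounds the cost per consumer from below by
  \<open>H_avg n z - z \<bullet> (Q\<^sub>0 n / n)\<close>, since \<open>\<rho>\<close> dominates \<open>z\<close>. For the reverse inequality, replace each set by
  its convex hull. Minimising \<open>\<rho>\<close> over a convex set is dual to maximising over the polar
  (\<open>exists_dominated_functional\<close>, a separation argument), so the relaxed cost is at most such a lower bound,
  for a suitable \<open>z\<close>. The relaxed optimum is then rounded to points of the original sets: choosing them
  one by one, so that each new error makes no acute angle with the accumulated error, keeps the
  squared error at most \<open>\<Sum>i<n. (2 * set_norm (R\<^sub>i))\<^sup>2\<close> (\<open>greedy_rounding\<close>). This is \<open>o(n\<^sup>2)\<close> when the averages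
  of the norms converge (\<open>mean_square_vanishes\<close>), so the duality gap per consumer vanishes and the cost
  converges to the maximum over the polar of \<open>H z - z \<bullet> q\<^sub>0\<close>.

  Prices. The mean consumption at price \<open>p\<close> is a supergradient of the concave function \<open>H_avg n\<close> at
  \<open>p\<close>. Its directional components are squeezed between difference quotients of \<open>H_avg n\<close>, which converge
  to those of \<open>H\<close>; differentiability of \<open>H\<close> at \<open>p\<close> therefore forces the mean consumption to converge to
  the gradient, whichever minimisers the consumers choose.
\<close>

section \<open>The strong law of large numbers\<close>

text \<open>The largest of the partial sums of \<open>x\<close> with at most \<open>n\<close> summands, the empty one included. The
  recursion removes the first summand, so that it compares the maximum for \<open>x\<close> with the maximum for
  the shifted sequence.\<close>

fun max_sum :: "nat \<Rightarrow> (nat \<Rightarrow> real) \<Rightarrow> real" where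
  "max_sum 0 x = 0"
| "max_sum (Suc n) x = max 0 (x 0 + max_sum n (\<lambda>i. x (Suc i)))"

lemma max_sum_ge: "k \<le> n \<Longrightarrow> (\<Sum>i<k. x i) \<le> max_sum n x"
proof (induction n arbitrary: k x)
  case (Suc n)
  show ?case
  proof (cases k)
    case (Suc l)
    with Suc.IH[of l "\<lambda>i. x (Suc i)"] Suc.prems show ?thesis
      by (simp add: sum.lessThan_Suc_shift del: sum.lessThan_Suc)
  qed simp
qed simp

lemma max_sum_nonneg: "0 \<le> max_sum n x"
  using max_sum_ge[of 0 n x] by simp

lemma max_sum_mono: "max_sum n x \<le> max_sum (Suc n) x"
proof (induction n arbitrary: x)
  case (Suc n)
  show ?case using Suc.IH[of "\<lambda>i. x (Suc i)"] by simp
qed simp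

lemma max_sum_abs_le: "max_sum n x \<le> (\<Sum>i<n. \<bar>x i\<bar>)"
proof (induction n arbitrary: x)
  case (Suc n)
  have "0 \<le> (\<Sum>i<n. \<bar>x (Suc i)\<bar>)" by (rule sum_nonneg) simp
  then show ?case using Suc.IH[of "\<lambda>i. x (Suc i)"]
    by (simp add: sum.lessThan_Suc_shift del: sum.lessThan_Suc)
qed simp

lemma measurable_max_sum:
  fixes X :: "nat \<Rightarrow> 'a \<Rightarrow> real"
  assumes "\<And>i. X i \<in> borel_measurable M"
  shows "(\<lambda>\<omega>. max_sum n (\<lambda>i. X i \<omega>)) \<in> borel_measurable M"
  using assms
proof (induction n arbitrary: X)
  case (Suc n)
  have [measurable]: "(\<lambda>\<omega>. max_sum n (\<lambda>i. X (Suc i) \<omega>)) \<in> borel_measurable M"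
    by (rule Suc.IH) (rule Suc.prems)
  note [measurable] = Suc.prems
  show ?case by simp
qed simp

definition unbounded_sums :: "(nat \<Rightarrow> real) \<Rightarrow> bool" where
  "unbounded_sums x \<longleftrightarrow> (\<forall>m::nat. \<exists>n. real m \<le> (\<Sum>i<n. x i))"

lemma unbounded_sums_shift: "unbounded_sums (\<lambda>i. x (Suc i)) \<longleftrightarrow> unbounded_sums x"
proof
  assume u: "unbounded_sums (\<lambda>i. x (Suc i))"
  show "unbounded_sums x" unfolding unbounded_sums_def
  proof
    fix m :: nat
    obtain k :: nat where k: "real m - x 0 \<le> real k" using real_arch_simple by blast
    obtain n where "real k \<le> (\<Sum>i<n. x (Suc i))" using u unfolding unbounded_sums_def by blast
    then have "real m \<le> (\<Sum>i<Suc n. x i)" using k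
      by (simp add: sum.lessThan_Suc_shift del: sum.lessThan_Suc)
    then show "\<exists>n. real m \<le> (\<Sum>i<n. x i)" ..
  qed
next
  assume u: "unbounded_sums x"
  show "unbounded_sums (\<lambda>i. x (Suc i))" unfolding unbounded_sums_def
  proof
    fix m :: nat
    obtain k :: nat where k: "max (real m + x 0) 1 \<le> real k" using real_arch_simple by blast
    obtain n where n: "real k \<le> (\<Sum>i<n. x i)" using u unfolding unbounded_sums_def by blast
    with k obtain l where "n = Suc l" by (cases n) auto
    with n k have "real m \<le> (\<Sum>i<l. x (Suc i))"
      by (simp add: sum.lessThan_Suc_shift del: sum.lessThan_Suc)
    then show "\<exists>n. real m \<le> (\<Sum>i<n. x (Suc i))" ..
  qed
qed

lemma unbounded_sums_shifts: "unbounded_sums (\<lambda>i. x (i + n)) \<longleftrightarrow> unbounded_sums x"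
proof (induction n)
  case (Suc n)
  have "unbounded_sums (\<lambda>i. x (Suc i + n)) \<longleftrightarrow> unbounded_sums (\<lambda>i. x (i + n))"
    by (rule unbounded_sums_shift[of "\<lambda>i. x (i + n)"])
  then show ?case using Suc.IH by simp
qed simp

context prob_space begin

text \<open>Unbounded growth of the partial sums ignores any finite number of summands and hence is a tail
  event.\<close>

lemma unbounded_sums_0_1:
  fixes X :: "nat \<Rightarrow> 'a \<Rightarrow> real"
  assumes ind: "indep_vars (\<lambda>_. borel) X UNIV"
  shows "prob {\<omega> \<in> space M. unbounded_sums (\<lambda>i. X i \<omega>)} \<in> {0, 1}"
proof -
  define A where "A = (\<lambda>i. sigma_sets (space M) {X i -` B \<inter> space M | B. B \<in> sets (borel :: real measure)})"
  have rv: "X i \<in> borel_measurable M" for i using ind unfolding indep_vars_def2 by auto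
  have indep: "indep_sets A UNIV" using ind unfolding indep_vars_def A_def by auto
  have alg: "sigma_algebra (space M) (A i)" for i
    unfolding A_def by (rule sigma_algebra_sigma_sets) auto
  have "{\<omega> \<in> space M. unbounded_sums (\<lambda>i. X i \<omega>)} \<in> sigma_sets (space M) (\<Union> (A ` {n..}))" for n
  proof -
    define G where "G = sigma (space M) (\<Union> (A ` {n..}))"
    have sub: "\<Union> (A ` {n..}) \<subseteq> Pow (space M)"
      using sigma_algebra_iff2[THEN iffD1, OF alg] by (intro UN_least) simp
    have sets_G: "sets G = sigma_sets (space M) (\<Union> (A ` {n..}))" and space_G: "space G = space M"
      unfolding G_def using sub by auto
    have [measurable]: "X (i + n) \<in> borel_measurable G" for i
    proof (rule measurableI)
      fix B :: "real set" assume "B \<in> sets borel"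
      then have "X (i + n) -` B \<inter> space M \<in> \<Union> (A ` {n..})"
        unfolding A_def by (auto intro!: bexI[of _ "i + n"])
      then show "X (i + n) -` B \<inter> space G \<in> sets G" unfolding sets_G space_G by auto
    qed simp
    have "{\<omega> \<in> space G. unbounded_sums (\<lambda>i. X (i + n) \<omega>)} \<in> sets G"
      unfolding unbounded_sums_def by measurable
    then show ?thesis unfolding sets_G space_G using unbounded_sums_shifts[of "\<lambda>i. X i _" n] by simp
  qed
  then have "{\<omega> \<in> space M. unbounded_sums (\<lambda>i. X i \<omega>)} \<in> tail_events A"
    unfolding tail_events_def by blast
  from kolmogorov_0_1_law[OF alg indep this] show ?thesis by simp
qed

lemma iid_shift_distr:
  fixes X :: "nat \<Rightarrow> 'a \<Rightarrow> real"
  assumes ind: "indep_vars (\<lambda>_. borel) X UNIV"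
    and id: "\<And>i. distr M borel (X i) = distr M borel (X 0)"
  shows "distr M (\<Pi>\<^sub>M i\<in>UNIV. borel) (\<lambda>\<omega> i. X (Suc i) \<omega>) = distr M (\<Pi>\<^sub>M i\<in>UNIV. borel) (\<lambda>\<omega> i. X i \<omega>)"
proof -
  have rv: "X i \<in> borel_measurable M" for i using ind unfolding indep_vars_def2 by auto
  let ?B = "\<Pi>\<^sub>M i\<in>(UNIV :: nat set). (borel :: real measure)"
  let ?D = "\<Pi>\<^sub>M i\<in>(UNIV :: nat set). distr M borel (X 0)"
  have id': "(\<lambda>i. distr M borel (X i)) = (\<lambda>_. distr M borel (X 0))" using id by (rule ext)
  have seq [measurable]: "(\<lambda>\<omega> i. X i \<omega>) \<in> measurable M ?B"
    using rv by (auto intro!: measurable_PiM_single')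
  have shift: "(\<lambda>x i. x (Suc i)) \<in> measurable ?B ?B"
    by (auto intro!: measurable_PiM_single')
  have law: "distr M ?B (\<lambda>\<omega> i. X i \<omega>) = ?D"
    using iffD1[OF indep_vars_iff_distr_eq_PiM[of UNIV X "\<lambda>_. borel", OF UNIV_not_empty rv] ind]
    unfolding id' restrict_UNIV .
  have "distr M ?B (\<lambda>\<omega> i. X (Suc i) \<omega>) = distr ?D ?B (\<lambda>x i. x (Suc i))"
    unfolding law[symmetric] distr_distr[OF shift seq] comp_def ..
  also have "\<dots> = distr ?D ?D (\<lambda>x i. x (Suc i))"
    by (intro distr_cong refl sets_PiM_cong) (simp only: sets_distr)
  also have "\<dots> = ?D"
    using distr_PiM_reindex[of UNIV "\<lambda>_. distr M borel (X 0)" Suc UNIV] rv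
    by (simp add: restrict_UNIV prob_space_distr)
  finally show ?thesis using law by simp
qed

text \<open>Let \<open>S\<^sub>n\<close> be the maximal partial sum of \<open>X\<close> and \<open>T\<^sub>n\<close> that of the shifted sequence. They have the same
  mean, and \<open>S\<^sub>n\<^sub>+\<^sub>1 - T\<^sub>n = max (- T\<^sub>n) (X 0)\<close>. Since the maxima increase in \<open>n\<close>, the mean of the right-hand side
  is nonnegative. If the partial sums were unbounded with positive probability, they would be
  unbounded almost surely; then \<open>T\<^sub>n\<close> tends to infinity, the right-hand side tends to \<open>X 0\<close>, dominated by
  \<open>\<bar>X 0\<bar>\<close>, and \<open>X 0\<close> would have nonnegative mean.\<close>

lemma bounded_sums_of_negative_mean:
  fixes X :: "nat \<Rightarrow> 'a \<Rightarrow> real"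
  assumes ind: "indep_vars (\<lambda>_. borel) X UNIV"
    and id: "\<And>i. distr M borel (X i) = distr M borel (X 0)"
    and int: "integrable M (X 0)" and neg: "expectation (X 0) < 0"
  shows "AE \<omega> in M. \<not> unbounded_sums (\<lambda>i. X i \<omega>)"
proof (rule ccontr)
  assume notAE: "\<not> ?thesis"
  have rv[measurable]: "X i \<in> borel_measurable M" for i using ind unfolding indep_vars_def2 by auto
  have ev: "{\<omega> \<in> space M. unbounded_sums (\<lambda>i. X i \<omega>)} \<in> events"
    unfolding unbounded_sums_def by measurable
  have intX: "integrable M (X i)" for i
  proof -
    have "integrable (distr M borel (X i)) (\<lambda>x. x)"
      using int by (subst id, subst integrable_distr_eq) auto
    then show ?thesis by (subst (asm) integrable_distr_eq) auto
  qed
  have "prob {\<omega> \<in> space M. unbounded_sums (\<lambda>i. X i \<omega>)} \<noteq> 0"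
  proof
    assume "prob {\<omega> \<in> space M. unbounded_sums (\<lambda>i. X i \<omega>)} = 0"
    with ev have "AE \<omega> in M. \<omega> \<notin> {\<omega> \<in> space M. unbounded_sums (\<lambda>i. X i \<omega>)}"
      by (simp add: prob_eq_0)
    then have "AE \<omega> in M. \<not> unbounded_sums (\<lambda>i. X i \<omega>)" using AE_space by eventually_elim auto
    with notAE show False by simp
  qed
  with unbounded_sums_0_1[OF ind] have "prob {\<omega> \<in> space M. unbounded_sums (\<lambda>i. X i \<omega>)} = 1" by auto
  then have ub: "AE \<omega> in M. unbounded_sums (\<lambda>i. X i \<omega>)"
    using prob_eq_1[OF ev] by (auto elim: eventually_mono)
  define S where "S = (\<lambda>n \<omega>. max_sum n (\<lambda>i. X i \<omega>))"
  define T where "T = (\<lambda>n \<omega>. max_sum n (\<lambda>i. X (Suc i) \<omega>))"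
  have Sm[measurable]: "S n \<in> borel_measurable M" and Tm[measurable]: "T n \<in> borel_measurable M" for n
    unfolding S_def T_def by (auto intro!: measurable_max_sum)
  have intS: "integrable M (S n)" for n
    unfolding S_def
    by (rule Bochner_Integration.integrable_bound[of _ "\<lambda>\<omega>. \<Sum>i<n. \<bar>X i \<omega>\<bar>"])
       (use intX max_sum_abs_le max_sum_nonneg Sm in \<open>auto simp: S_def\<close>)
  have intT: "integrable M (T n)" for n
    unfolding T_def
    by (rule Bochner_Integration.integrable_bound[of _ "\<lambda>\<omega>. \<Sum>i<n. \<bar>X (Suc i) \<omega>\<bar>"])
       (use intX max_sum_abs_le[of n "\<lambda>i. X (Suc i) _"] max_sum_nonneg Tm in \<open>auto simp: T_def\<close>)
  have ETS: "expectation (T n) = expectation (S n)" for n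
  proof -
    have [measurable]: "(\<lambda>x. max_sum n x) \<in> borel_measurable (\<Pi>\<^sub>M i\<in>UNIV. borel)"
      using measurable_max_sum[of "\<lambda>i x. x i" "\<Pi>\<^sub>M i\<in>UNIV. borel" n] by simp
    have "expectation (T n) = integral\<^sup>L (distr M (\<Pi>\<^sub>M i\<in>UNIV. borel) (\<lambda>\<omega> i. X (Suc i) \<omega>)) (max_sum n)"
      unfolding T_def by (subst integral_distr) (auto intro!: measurable_PiM_single')
    also have "\<dots> = expectation (S n)"
      unfolding S_def iid_shift_distr[OF ind id] by (subst integral_distr) (auto intro!: measurable_PiM_single')
    finally show ?thesis .
  qed
  have diff: "S (Suc n) \<omega> - T n \<omega> = max (- T n \<omega>) (X 0 \<omega>)" for n \<omega>
    unfolding S_def T_def by simp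
  have nonneg: "0 \<le> expectation (\<lambda>\<omega>. max (- T n \<omega>) (X 0 \<omega>))" for n
  proof -
    have "expectation (T n) \<le> expectation (S (Suc n))"
      unfolding ETS by (rule integral_mono[OF intS intS]) (auto simp: S_def max_sum_mono simp del: max_sum.simps)
    then show ?thesis
      using intS intT by (simp add: diff[symmetric] Bochner_Integration.integral_diff)
  qed
  have "(\<lambda>n. expectation (\<lambda>\<omega>. max (- T n \<omega>) (X 0 \<omega>))) \<longlonglongrightarrow> expectation (X 0)"
  proof (rule integral_dominated_convergence[where w = "\<lambda>\<omega>. \<bar>X 0 \<omega>\<bar>"])
    show "AE \<omega> in M. (\<lambda>n. max (- T n \<omega>) (X 0 \<omega>)) \<longlonglongrightarrow> X 0 \<omega>"
      using ub
    proof eventually_elim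
      case (elim \<omega>)
      then have "unbounded_sums (\<lambda>i. X (Suc i) \<omega>)" using unbounded_sums_shift[of "\<lambda>i. X i \<omega>"] by simp
      moreover obtain m :: nat where m: "- X 0 \<omega> \<le> real m" using real_arch_simple by blast
      ultimately obtain k where k: "real m \<le> (\<Sum>i<k. X (Suc i) \<omega>)" unfolding unbounded_sums_def by blast
      have "max (- T n \<omega>) (X 0 \<omega>) = X 0 \<omega>" if "k \<le> n" for n
        using max_sum_ge[OF that, of "\<lambda>i. X (Suc i) \<omega>"] k m unfolding T_def by (simp add: max_def)
      then show ?case
        by (intro tendsto_eventually) (auto simp: eventually_sequentially)
    qed
    show "AE \<omega> in M. norm (max (- T n \<omega>) (X 0 \<omega>)) \<le> \<bar>X 0 \<omega>\<bar>" for n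
    proof (rule AE_I2)
      fix \<omega> have "0 \<le> T n \<omega>" unfolding T_def by (rule max_sum_nonneg)
      then show "norm (max (- T n \<omega>) (X 0 \<omega>)) \<le> \<bar>X 0 \<omega>\<bar>" by (auto simp: max_def)
    qed
  qed (use int in auto)
  then have "0 \<le> expectation (X 0)"
    by (rule LIMSEQ_le_const) (use nonneg in auto)
  with neg show False by simp
qed

lemma averages_eventually_below:
  fixes X :: "nat \<Rightarrow> 'a \<Rightarrow> real"
  assumes ind: "indep_vars (\<lambda>_. borel) X UNIV"
    and id: "\<And>i. distr M borel (X i) = distr M borel (X 0)"
    and int: "integrable M (X 0)" and c: "expectation (X 0) < c"
  shows "AE \<omega> in M. \<forall>\<^sub>F n in sequentially. (\<Sum>i<n. X i \<omega>) / real n < c"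
proof -
  have rv[measurable]: "X i \<in> borel_measurable M" for i using ind unfolding indep_vars_def2 by auto
  obtain b where b: "expectation (X 0) < b" "b < c" using c dense by blast
  define Y where "Y = (\<lambda>i \<omega>. X i \<omega> - b)"
  have "AE \<omega> in M. \<not> unbounded_sums (\<lambda>i. Y i \<omega>)"
  proof (rule bounded_sums_of_negative_mean)
    show "indep_vars (\<lambda>_. borel) Y UNIV" unfolding Y_def
      by (rule indep_vars_compose2[OF ind, where Y = "\<lambda>_ x. x - b"]) simp
    have law: "distr M borel (Y i) = distr (distr M borel (X i)) borel (\<lambda>x. x - b)" for i
      unfolding Y_def by (subst distr_distr) (auto simp: comp_def)
    show "distr M borel (Y i) = distr M borel (Y 0)" for i
      unfolding law[of i] law[of 0] id[of i] ..
    show "integrable M (Y 0)" unfolding Y_def using int by auto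
    show "expectation (Y 0) < 0" unfolding Y_def using int b by (simp add: prob_space)
  qed
  then show ?thesis
  proof eventually_elim
    case (elim \<omega>)
    then obtain m :: nat where m: "\<And>n. (\<Sum>i<n. Y i \<omega>) < real m"
      unfolding unbounded_sums_def by (auto simp: not_le)
    obtain k :: nat where k: "real m / (c - b) < real k" using reals_Archimedean2 by blast
    have "(\<Sum>i<n. X i \<omega>) / real n < c" if "Suc k \<le> n" for n
    proof -
      have "(\<Sum>i<n. X i \<omega>) = (\<Sum>i<n. Y i \<omega>) + real n * b" unfolding Y_def by (simp add: sum_subtractf)
      also have "\<dots> < real m + real n * b" using m[of n] by simp
      also have "real m < real k * (c - b)" using k b by (simp add: field_simps)
      also have "real k * (c - b) \<le> real n * (c - b)" using b that by (intro mult_right_mono) auto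
      finally show ?thesis using that by (simp add: field_simps)
    qed
    then show ?case by (auto simp: eventually_sequentially)
  qed
qed

text \<open>If \<open>b\<close> exceeds the mean, the partial sums of \<open>X i - b\<close> are bounded above, so the averages of \<open>X\<close> are
  eventually below any \<open>c > b\<close>. Applied to \<open>X\<close> and to \<open>- X\<close>, this confines the averages to every
  neighbourhood of the mean.\<close>

theorem strong_law_of_large_numbers:
  fixes X :: "nat \<Rightarrow> 'a \<Rightarrow> real"
  assumes ind: "indep_vars (\<lambda>_. borel) X UNIV"
    and id: "\<And>i. distr M borel (X i) = distr M borel (X 0)"
    and int: "integrable M (X 0)"
  shows "AE \<omega> in M. (\<lambda>n. (\<Sum>i<n. X i \<omega>) / real n) \<longlonglongrightarrow> expectation (X 0)"
proof -
  have rv[measurable]: "X i \<in> borel_measurable M" for i using ind unfolding indep_vars_def2 by auto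
  let ?e = "\<lambda>k. inverse (real (Suc k))"
  have up: "AE \<omega> in M. \<forall>k. \<forall>\<^sub>F n in sequentially. (\<Sum>i<n. X i \<omega>) / real n < expectation (X 0) + ?e k"
    unfolding AE_all_countable
    by (intro allI averages_eventually_below[OF ind id int]) simp
  have "AE \<omega> in M. \<forall>\<^sub>F n in sequentially. (\<Sum>i<n. - X i \<omega>) / real n < - expectation (X 0) + ?e k" for k
  proof (rule averages_eventually_below)
    show "indep_vars (\<lambda>_. borel) (\<lambda>i \<omega>. - X i \<omega>) UNIV"
      by (rule indep_vars_compose2[OF ind, where Y = "\<lambda>_ x. - x"]) simp
    have law: "distr M borel (\<lambda>\<omega>. - X i \<omega>) = distr (distr M borel (X i)) borel (\<lambda>x. - x)" for i
      by (subst distr_distr) (auto simp: comp_def)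
    show "distr M borel (\<lambda>\<omega>. - X i \<omega>) = distr M borel (\<lambda>\<omega>. - X 0 \<omega>)" for i
      unfolding law[of i] law[of 0] id[of i] ..
  qed (use int in auto)
  then have lo: "AE \<omega> in M. \<forall>k. \<forall>\<^sub>F n in sequentially. (\<Sum>i<n. - X i \<omega>) / real n < - expectation (X 0) + ?e k"
    unfolding AE_all_countable by blast
  from up lo show ?thesis
  proof eventually_elim
    case (elim \<omega>)
    show ?case
    proof (rule LIMSEQ_I)
      fix r :: real assume "0 < r"
      then obtain k where k: "?e k < r" using reals_Archimedean by blast
      have "\<forall>\<^sub>F n in sequentially. norm ((\<Sum>i<n. X i \<omega>) / real n - expectation (X 0)) < r"
        using elim(1)[rule_format, of k] elim(2)[rule_format, of k]
        by eventually_elim (use k in \<open>simp add: sum_negf\<close>)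
      then show "\<exists>N. \<forall>n\<ge>N. norm ((\<Sum>i<n. X i \<omega>) / real n - expectation (X 0)) < r"
        by (simp add: eventually_sequentially)
    qed
  qed
qed

end

section \<open>Support functions and norms of compact sets\<close>

lemma min_support_eqI:
  assumes "x \<in> C" "\<And>y. y \<in> C \<Longrightarrow> x \<bullet> p \<le> y \<bullet> p"
  shows "min_support p C = x \<bullet> p"
  unfolding min_support_def using assms by (intro Least_equality) auto

lemma min_support_attained:
  assumes "C \<in> nonempty_compacts"
  obtains x where "x \<in> C" "x \<bullet> p = min_support p C" "\<And>y. y \<in> C \<Longrightarrow> min_support p C \<le> y \<bullet> p"
proof -
  have "continuous_on C (\<lambda>x. x \<bullet> p)" by (intro continuous_intros)
  with assms obtain x where x: "x \<in> C" "\<And>y. y \<in> C \<Longrightarrow> x \<bullet> p \<le> y \<bullet> p"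
    unfolding nonempty_compacts_def using continuous_attains_inf[of C "\<lambda>x. x \<bullet> p"] by auto
  with min_support_eqI[OF x] that show thesis by metis
qed

lemma min_support_le:
  assumes "C \<in> nonempty_compacts" "y \<in> C"
  shows "min_support p C \<le> y \<bullet> p"
  using min_support_attained[OF assms(1)] assms(2) by metis

lemma norm_le_set_norm:
  assumes "C \<in> nonempty_compacts" "y \<in> C"
  shows "norm y \<le> set_norm C"
proof -
  have "bounded C" using assms(1) by (auto simp: nonempty_compacts_def compact_imp_bounded)
  then obtain B where "\<And>x. x \<in> C \<Longrightarrow> norm x \<le> B" unfolding bounded_iff by blast
  then have "bdd_above (norm ` C)" by (auto intro!: bdd_aboveI)
  then show ?thesis unfolding set_norm_def using assms(2) by (rule cSUP_upper2) simp
qed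

lemma set_norm_nonneg:
  assumes "C \<in> nonempty_compacts"
  shows "0 \<le> set_norm C"
  using assms norm_le_set_norm[OF assms] norm_ge_zero unfolding nonempty_compacts_def
  by (metis (mono_tags, lifting) all_not_in_conv mem_Collect_eq order_trans)

lemma min_support_diff_le:
  assumes "C \<in> nonempty_compacts"
  shows "min_support p C - min_support p' C \<le> set_norm C * norm (p - p')"
proof -
  obtain x where x: "x \<in> C" "x \<bullet> p' = min_support p' C" using min_support_attained[OF assms] by metis
  have "min_support p C - min_support p' C \<le> x \<bullet> (p - p')"
    using min_support_le[OF assms x(1), of p] x(2) by (simp add: inner_diff_right)
  also have "\<dots> \<le> norm x * norm (p - p')" by (rule norm_cauchy_schwarz)
  also have "\<dots> \<le> set_norm C * norm (p - p')"
    by (intro mult_right_mono norm_le_set_norm[OF assms x(1)]) simp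
  finally show ?thesis .
qed

lemma min_support_lipschitz:
  assumes "C \<in> nonempty_compacts"
  shows "\<bar>min_support p C - min_support p' C\<bar> \<le> set_norm C * norm (p - p')"
  using min_support_diff_le[OF assms, of p p'] min_support_diff_le[OF assms, of p' p]
  by (simp add: abs_le_iff norm_minus_commute)

lemma continuous_on_min_support:
  assumes "C \<in> nonempty_compacts"
  shows "continuous_on A (\<lambda>p. min_support p C)"
proof (rule continuous_on_subset[OF lipschitz_on_continuous_on])
  show "(set_norm C)-lipschitz_on UNIV (\<lambda>p. min_support p C)"
    using min_support_lipschitz[OF assms] set_norm_nonneg[OF assms]
    by (intro lipschitz_onI) (auto simp: dist_norm)
qed simp

lemma abs_min_support_le:
  assumes "C \<in> nonempty_compacts"
  shows "\<bar>min_support p C\<bar> \<le> set_norm C * norm p"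
proof -
  obtain x where x: "x \<in> C" "x \<bullet> p = min_support p C" using min_support_attained[OF assms] by metis
  have "\<bar>x \<bullet> p\<bar> \<le> norm x * norm p" by (rule Cauchy_Schwarz_ineq2)
  also have "\<dots> \<le> set_norm C * norm p"
    by (intro mult_right_mono norm_le_set_norm[OF assms x(1)]) simp
  finally show ?thesis using x(2) by simp
qed

section \<open>Rounding points of convex hulls\<close>

definition minkowski_sum :: "nat \<Rightarrow> (nat \<Rightarrow> 'a::real_normed_vector set) \<Rightarrow> 'a set" where
  "minkowski_sum n S = {\<Sum>i<n. x i | x. \<forall>i<n. x i \<in> S i}"

lemma minkowski_sumI: "(\<And>i. i < n \<Longrightarrow> x i \<in> S i) \<Longrightarrow> (\<Sum>i<n. x i) \<in> minkowski_sum n S"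
  unfolding minkowski_sum_def by blast

lemma minkowski_sum_Suc: "minkowski_sum (Suc n) S = {x + y | x y. x \<in> minkowski_sum n S \<and> y \<in> S n}"
proof (intro equalityI subsetI)
  fix z assume "z \<in> minkowski_sum (Suc n) S"
  then obtain x where "z = (\<Sum>i<n. x i) + x n" "\<forall>i<Suc n. x i \<in> S i" unfolding minkowski_sum_def by auto
  then show "z \<in> {x + y | x y. x \<in> minkowski_sum n S \<and> y \<in> S n}"
    using minkowski_sumI[of n x S] by (intro CollectI exI[of _ "\<Sum>i<n. x i"] exI[of _ "x n"]) simp
next
  fix z assume "z \<in> {x + y | x y. x \<in> minkowski_sum n S \<and> y \<in> S n}"
  then obtain x y where z: "z = (\<Sum>i<n. x i) + y" and xy: "\<forall>i<n. x i \<in> S i" "y \<in> S n"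
    unfolding minkowski_sum_def by auto
  have "z = (\<Sum>i<Suc n. (x(n := y)) i)" unfolding z by simp
  then show "z \<in> minkowski_sum (Suc n) S"
    unfolding minkowski_sum_def using xy by (auto intro!: exI[of _ "x(n := y)"] simp: less_Suc_eq)
qed

lemma minkowski_sum_compact:
  assumes "\<And>i. i < n \<Longrightarrow> S i \<in> nonempty_compacts"
  shows "minkowski_sum n S \<in> nonempty_compacts"
  using assms
proof (induction n)
  case 0
  have "minkowski_sum 0 S = {0}" unfolding minkowski_sum_def by auto
  then show ?case by (simp add: nonempty_compacts_def)
next
  case (Suc n)
  then have "minkowski_sum n S \<in> nonempty_compacts" "S n \<in> nonempty_compacts" by auto
  then show ?case unfolding minkowski_sum_Suc nonempty_compacts_def
    by (auto intro!: compact_sums)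
qed

lemma minkowski_sum_convex:
  assumes "\<And>i. i < n \<Longrightarrow> convex (S i)"
  shows "convex (minkowski_sum n S)"
proof (rule convexI)
  fix x y and u v :: real
  assume uv: "0 \<le> u" "0 \<le> v" "u + v = 1"
    and "x \<in> minkowski_sum n S" "y \<in> minkowski_sum n S"
  then obtain f g where f: "x = (\<Sum>i<n. f i)" "\<forall>i<n. f i \<in> S i" and g: "y = (\<Sum>i<n. g i)" "\<forall>i<n. g i \<in> S i"
    unfolding minkowski_sum_def by auto
  have "u *\<^sub>R x + v *\<^sub>R y = (\<Sum>i<n. u *\<^sub>R f i + v *\<^sub>R g i)"
    unfolding f g by (simp add: sum.distrib scaleR_sum_right)
  also have "\<dots> \<in> minkowski_sum n S"
    using f g uv assms by (intro minkowski_sumI) (auto intro: convexD)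
  finally show "u *\<^sub>R x + v *\<^sub>R y \<in> minkowski_sum n S" .
qed

text \<open>Otherwise \<open>S\<close>, and with it its convex hull, would lie in an open half-space that excludes \<open>x\<close>.\<close>

lemma exists_hull_point_below:
  assumes "x \<in> convex hull S"
  shows "\<exists>y\<in>S. v \<bullet> y \<le> v \<bullet> x"
proof (rule ccontr)
  assume "\<not> ?thesis"
  then have "S \<subseteq> {y. v \<bullet> y > v \<bullet> x}" by force
  then have "convex hull S \<subseteq> {y. v \<bullet> y > v \<bullet> x}"
    by (rule hull_minimal) (rule convex_halfspace_gt)
  with assms show False by auto
qed

text \<open>An elementary substitute for the Shapley--Folkman theorem. Writing \<open>v\<close> for the error accumulated
  before step \<open>n\<close>, some \<open>y \<in> S n\<close> satisfies \<open>v \<bullet> (y - x n) \<le> 0\<close>, so the squared errors add up at most as in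
  the theorem of Pythagoras. The bound is of order \<open>n\<close> for uniformly bounded sets, while the trivial
  bound is of order \<open>n\<^sup>2\<close>.\<close>

lemma greedy_rounding:
  fixes x :: "nat \<Rightarrow> 'a::euclidean_space"
  assumes "\<And>i. i < n \<Longrightarrow> x i \<in> convex hull (S i)"
    and "\<And>i y. i < n \<Longrightarrow> y \<in> S i \<Longrightarrow> norm y \<le> a i"
  shows "\<exists>q. (\<forall>i<n. q i \<in> S i) \<and> (norm (\<Sum>i<n. q i - x i))\<^sup>2 \<le> (\<Sum>i<n. (2 * a i)\<^sup>2)"
  using assms
proof (induction n)
  case (Suc n)
  then obtain q where q: "\<forall>i<n. q i \<in> S i" "(norm (\<Sum>i<n. q i - x i))\<^sup>2 \<le> (\<Sum>i<n. (2 * a i)\<^sup>2)"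
    by auto
  define v where "v = (\<Sum>i<n. q i - x i)"
  obtain y where y: "y \<in> S n" "v \<bullet> y \<le> v \<bullet> x n"
    using exists_hull_point_below[of "x n" "S n" v] Suc.prems(1) by auto
  have "convex hull (S n) \<subseteq> cball 0 (a n)"
    using Suc.prems(2)[of n] by (intro hull_minimal convex_cball) auto
  then have "norm (x n) \<le> a n" using Suc.prems(1)[of n] by auto
  moreover have "norm y \<le> a n" using Suc.prems(2) y by auto
  ultimately have "norm (y - x n) \<le> 2 * a n" using norm_triangle_ineq4[of y "x n"] by linarith
  then have d: "(norm (y - x n))\<^sup>2 \<le> (2 * a n)\<^sup>2" by (intro power_mono) auto
  have "(norm (v + (y - x n)))\<^sup>2 = (norm v)\<^sup>2 + 2 * (v \<bullet> (y - x n)) + (norm (y - x n))\<^sup>2"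
    by (simp add: power2_norm_eq_inner inner_add_left inner_add_right inner_commute)
  also have "\<dots> \<le> (\<Sum>i<n. (2 * a i)\<^sup>2) + (2 * a n)\<^sup>2"
    using q(2) d y(2) unfolding v_def[symmetric] by (simp add: inner_diff_right)
  finally have "(norm (v + (y - x n)))\<^sup>2 \<le> (\<Sum>i<Suc n. (2 * a i)\<^sup>2)" by simp
  moreover have "(\<Sum>i<Suc n. (q(n := y)) i - x i) = v + (y - x n)" unfolding v_def by simp
  ultimately show ?case
    using q(1) y(1) by (intro exI[of _ "q(n := y)"]) (auto simp: less_Suc_eq)
qed simp

text \<open>Convergent averages force \<open>a n / n \<longlonglongrightarrow> 0\<close>. Hence \<open>a i \<le> e * n + C\<close> for all \<open>i < n\<close>, and
  \<open>\<Sum>i<n. (a i)\<^sup>2 \<le> (e * n + C) * (\<Sum>i<n. a i)\<close>.\<close>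

lemma mean_square_vanishes:
  fixes a :: "nat \<Rightarrow> real"
  assumes nonneg: "\<And>i. 0 \<le> a i" and lim: "(\<lambda>n. (\<Sum>i<n. a i) / real n) \<longlonglongrightarrow> c"
  shows "(\<lambda>n. (\<Sum>i<n. (a i)\<^sup>2) / (real n)\<^sup>2) \<longlonglongrightarrow> 0"
proof (rule LIMSEQ_I)
  fix r :: real assume r: "0 < r"
  let ?A = "\<lambda>n. (\<Sum>i<n. a i) / real n"
  have "0 \<le> c" using lim by (rule LIMSEQ_le_const) (auto intro!: exI[of _ 0] sum_nonneg divide_nonneg_nonneg nonneg)
  define e where "e = r / (2 * (c + 1))"
  have e: "0 < e" using r \<open>0 \<le> c\<close> unfolding e_def by simp
  have shift: "(\<lambda>n. (\<Sum>i<Suc n. a i) / real (Suc n)) \<longlonglongrightarrow> c" using lim by (rule LIMSEQ_Suc)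
  have "(\<lambda>n. ?A (Suc n) * (real (Suc n) / real n) - ?A n) \<longlonglongrightarrow> c * 1 - c"
    by (intro tendsto_diff tendsto_mult lim shift LIMSEQ_Suc_n_over_n)
  moreover have "?A (Suc n) * (real (Suc n) / real n) - ?A n = a n / real n" for n
  proof -
    have "(s + x) / m * (m / k) - s / k = x / k" if "m \<noteq> 0" for s x m k :: real
    proof -
      have "(s + x) / m * (m / k) = (s + x) / k" using that by simp
      then show ?thesis by (simp add: add_divide_distrib)
    qed
    then show ?thesis unfolding sum.lessThan_Suc using of_nat_neq_0 by blast
  qed
  ultimately have "(\<lambda>n. a n / real n) \<longlonglongrightarrow> 0" by simp
  then have "\<forall>\<^sub>F n in sequentially. a n / real n < e" using e by (rule order_tendstoD)
  then have "\<forall>\<^sub>F n in sequentially. a n \<le> e * real n"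
    using eventually_gt_at_top[of 0] by eventually_elim (simp add: field_simps)
  then obtain N where N: "\<And>n. N \<le> n \<Longrightarrow> a n \<le> e * real n" unfolding eventually_sequentially by blast
  define C where "C = (\<Sum>i<N. a i)"
  have C: "0 \<le> C" unfolding C_def by (intro sum_nonneg nonneg)
  \<comment> \<open>The finitely many indices without the linear bound are absorbed into \<open>C\<close>.\<close>
  have bound: "a i \<le> e * real n + C" if "i < n" for i n
  proof (cases "i < N")
    case True
    then have "a i \<le> C" unfolding C_def by (intro member_le_sum) (auto simp: nonneg)
    then show ?thesis using e by (simp add: add_increasing)
  next
    case False
    then have "a i \<le> e * real i" using N by simp
    also have "\<dots> \<le> e * real n" using that e by simp
    finally show ?thesis using C by simp
  qed
  have sq: "(\<Sum>i<n. (a i)\<^sup>2) / (real n)\<^sup>2 \<le> (e + C / real n) * ?A n" if "0 < n" for n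
  proof -
    have "(\<Sum>i<n. (a i)\<^sup>2) \<le> (\<Sum>i<n. (e * real n + C) * a i)"
      unfolding power2_eq_square using bound nonneg by (intro sum_mono mult_right_mono) auto
    then have "(\<Sum>i<n. (a i)\<^sup>2) \<le> (e * real n + C) * (\<Sum>i<n. a i)" by (simp only: sum_distrib_left)
    then have "(\<Sum>i<n. (a i)\<^sup>2) / (real n)\<^sup>2 \<le> (e * real n + C) * (\<Sum>i<n. a i) / (real n)\<^sup>2"
      by (rule divide_right_mono) simp
    also have "\<dots> = ((e * real n + C) / real n) * ?A n" by (simp add: power2_eq_square)
    also have "(e * real n + C) / real n = e + C / real n" using that by (simp add: add_divide_distrib)
    finally show ?thesis .
  qed
  have "(\<lambda>n. (e + C / real n) * ?A n) \<longlonglongrightarrow> (e + 0) * c"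
    by (intro tendsto_intros lim lim_const_over_n)
  moreover have "(e + 0) * c < r"
  proof -
    have "e * c \<le> r / 2" unfolding e_def using \<open>0 \<le> c\<close> r by (simp add: field_simps)
    then show ?thesis using r by simp
  qed
  ultimately have "\<forall>\<^sub>F n in sequentially. (e + C / real n) * ?A n < r" by (rule order_tendstoD)
  then have "\<forall>\<^sub>F n in sequentially. norm ((\<Sum>i<n. (a i)\<^sup>2) / (real n)\<^sup>2 - 0) < r"
    using eventually_gt_at_top[of 0]
  proof eventually_elim
    case (elim n)
    have "0 \<le> (\<Sum>i<n. (a i)\<^sup>2) / (real n)\<^sup>2" by (intro divide_nonneg_nonneg sum_nonneg) auto
    with sq[OF elim(2)] elim(1) show ?case by simp
  qed
  then show "\<exists>N. \<forall>n\<ge>N. norm ((\<Sum>i<n. (a i)\<^sup>2) / (real n)\<^sup>2 - 0) < r"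
    by (simp add: eventually_sequentially)
qed

section \<open>Duality for sublinear costs\<close>

locale sublinear =
  fixes \<rho> :: "'a::euclidean_space \<Rightarrow> real"
  assumes convex: "convex_on UNIV \<rho>"
    and homogeneous: "\<And>\<alpha> x. 0 \<le> \<alpha> \<Longrightarrow> \<rho> (\<alpha> *\<^sub>R x) = \<alpha> * \<rho> x"
begin

lemma zero: "\<rho> 0 = 0"
  using homogeneous[of 0 0] by simp

lemma subadditive: "\<rho> (x + y) \<le> \<rho> x + \<rho> y"
proof -
  have "\<rho> ((1/2) *\<^sub>R x + (1/2) *\<^sub>R y) \<le> (1/2) * \<rho> x + (1/2) * \<rho> y"
    using convex_onD[OF convex, of "1/2" x y] by simp
  moreover have "\<rho> ((1/2) *\<^sub>R x + (1/2) *\<^sub>R y) = (1/2) * \<rho> (x + y)"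
    using homogeneous[of "1/2" "x + y"] by (simp add: scaleR_add_right)
  ultimately show ?thesis by simp
qed

lemma continuous: "continuous_on A \<rho>"
  using convex_on_continuous[OF open_UNIV convex] continuous_on_subset by blast

lemma linear_bound:
  obtains L where "0 \<le> L" "\<And>x. \<rho> x \<le> L * norm x"
proof -
  obtain B where B: "\<And>x. x \<in> sphere 0 1 \<Longrightarrow> \<bar>\<rho> x\<bar> \<le> B"
    using compact_imp_bounded[OF compact_continuous_image[OF continuous compact_sphere[of 0 1]]]
    unfolding bounded_iff image_iff real_norm_def by blast
  have "\<rho> x \<le> \<bar>B\<bar> * norm x" for x
  proof (cases "x = 0")
    case False
    have "\<rho> x = norm x * \<rho> (x /\<^sub>R norm x)"
      using homogeneous[of "norm x" "x /\<^sub>R norm x"] False by simp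
    also have "\<dots> \<le> norm x * \<bar>B\<bar>"
      using B[of "x /\<^sub>R norm x"] False by (intro mult_left_mono) auto
    finally show ?thesis by (simp add: mult.commute)
  qed (simp add: zero)
  then show thesis using that[of "\<bar>B\<bar>"] by simp
qed

lemma compact_polar: "compact (polar \<rho>)"
proof -
  obtain L where L: "0 \<le> L" "\<And>x. \<rho> x \<le> L * norm x" using linear_bound by blast
  have "norm z \<le> L" if "z \<in> polar \<rho>" for z
  proof -
    have "(norm z)\<^sup>2 \<le> L * norm z"
      using that L(2)[of z] unfolding polar_def power2_norm_eq_inner by (auto intro: order_trans)
    then show ?thesis using L(1) by (cases "z = 0") (auto simp: power2_eq_square)
  qed
  then have "bounded (polar \<rho>)" by (auto simp: bounded_iff)
  moreover have "closed (polar \<rho>)"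
    unfolding polar_def by (intro closed_Collect_all closed_Collect_le continuous_intros)
  ultimately show ?thesis by (simp add: compact_eq_bounded_closed)
qed

text \<open>The strict epigraph of \<open>\<rho>\<close> is a convex cone that does not meet \<open>K \<times> {m}\<close>. A hyperplane separating them
  can be moved to pass through the apex of the cone, and it is not vertical because \<open>\<rho>\<close> is finite
  everywhere; its slope is the required functional.\<close>

lemma exists_dominated_functional:
  assumes K: "convex K" "K \<noteq> {}" and m: "\<And>x. x \<in> K \<Longrightarrow> m \<le> \<rho> x"
  shows "\<exists>w\<in>polar \<rho>. \<forall>x\<in>K. m \<le> w \<bullet> x"
proof -
  let ?E = "{(y, t). \<rho> y < t}"
  let ?F = "K \<times> {m}"
  have "convex ?E"
  proof (rule convexI, clarsimp)
    fix x y and s t u v :: real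
    assume *: "\<rho> x < s" "\<rho> y < t" "0 \<le> u" "0 \<le> v" "u + v = 1"
    have "\<rho> (u *\<^sub>R x + v *\<^sub>R y) \<le> u * \<rho> x + v * \<rho> y"
      using subadditive[of "u *\<^sub>R x" "v *\<^sub>R y"] homogeneous * by simp
    also have "\<dots> < u * s + v * t"
    proof (cases "u = 0")
      case False
      then have "u * \<rho> x < u * s" using * by simp
      moreover have "v * \<rho> y \<le> v * t" using * by (intro mult_left_mono) auto
      ultimately show ?thesis by simp
    qed (use * in simp)
    finally show "\<rho> (u *\<^sub>R x + v *\<^sub>R y) < u * s + v * t" .
  qed
  moreover have "convex ?F" using K(1) by (intro convex_Times) auto
  moreover have "(0, 1) \<in> ?E" using zero by simp
  moreover have "?F \<inter> ?E = {}" using m by force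
  ultimately obtain a b where ab: "a \<noteq> 0" "\<And>x. x \<in> ?F \<Longrightarrow> a \<bullet> x \<le> b" "\<And>x. x \<in> ?E \<Longrightarrow> b \<le> a \<bullet> x"
    using separating_hyperplane_sets[of ?F ?E] K(2) by blast
  obtain w s where a: "a = (- w, s)" by (metis surj_pair minus_minus)
  have E: "b \<le> s * t - w \<bullet> y" if "\<rho> y < t" for y t
    using ab(3)[of "(y, t)"] that by (simp add: a)
  have "b \<le> 0"
  proof (rule field_le_epsilon)
    fix e :: real assume e: "0 < e"
    have "b \<le> s * (e / (\<bar>s\<bar> + 1))" using E[of 0 "e / (\<bar>s\<bar> + 1)"] e zero by simp
    also have "\<dots> \<le> (\<bar>s\<bar> + 1) * (e / (\<bar>s\<bar> + 1))" using e by (intro mult_right_mono) auto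
    finally show "b \<le> 0 + e" by simp
  qed
  \<comment> \<open>A negative value could be scaled along the cone to fall below \<open>b\<close>.\<close>
  have cone: "0 \<le> s * t - w \<bullet> y" if "\<rho> y < t" for y t
  proof (rule ccontr)
    assume "\<not> ?thesis"
    then have neg: "s * t - w \<bullet> y < 0" by simp
    define k where "k = (\<bar>b\<bar> + 1) / - (s * t - w \<bullet> y)"
    have k: "0 < k" unfolding k_def using neg by (intro divide_pos_pos) auto
    then have "\<rho> (k *\<^sub>R y) < k * t" using that homogeneous[of k y] by simp
    then have "b \<le> k * (s * t - w \<bullet> y)" using E[of "k *\<^sub>R y" "k * t"] by (simp add: algebra_simps)
    also have "\<dots> = - (\<bar>b\<bar> + 1)" unfolding k_def using neg by (simp add: field_simps)
    finally show False by linarith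
  qed
  have "0 \<le> s" using cone[of 0 1] zero by simp
  moreover have "s \<noteq> 0"
  proof
    assume "s = 0"
    then have "w \<bullet> w \<le> 0" using cone[of w "\<rho> w + 1"] by simp
    then have "w = 0" by (metis inner_gt_zero_iff not_less)
    with \<open>s = 0\<close> ab(1) a show False by (simp add: zero_prod_def)
  qed
  ultimately have s: "0 < s" by simp
  let ?w = "w /\<^sub>R s"
  have "?w \<bullet> y \<le> \<rho> y" for y
  proof (rule field_le_epsilon)
    fix e :: real assume "0 < e"
    then have "w \<bullet> y \<le> s * (\<rho> y + e)" using cone[of y "\<rho> y + e"] by simp
    then show "?w \<bullet> y \<le> \<rho> y + e" using s by (simp add: field_simps)
  qed
  then have "?w \<in> polar \<rho>" unfolding polar_def by simp
  moreover have "m \<le> ?w \<bullet> x" if "x \<in> K" for x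
  proof -
    have "s * m - w \<bullet> x \<le> 0" using ab(2)[of "(x, m)"] that \<open>b \<le> 0\<close> by (simp add: a)
    then show ?thesis using s by (simp add: field_simps)
  qed
  ultimately show ?thesis by blast
qed

lemma polar_nonempty: "polar \<rho> \<noteq> {}"
  using exists_dominated_functional[of "{0}" 0] zero by auto

lemma direct_cost_attained:
  assumes "\<And>i. i < n \<Longrightarrow> S i \<in> nonempty_compacts"
  shows "\<exists>x. (\<forall>i<n. x i \<in> S i)
    \<and> direct_cost (\<lambda>Q Q'. \<rho> (Q - Q')) n S Q = \<rho> ((\<Sum>i<n. x i) - Q)
    \<and> (\<forall>y. (\<forall>i<n. y i \<in> S i) \<longrightarrow> \<rho> ((\<Sum>i<n. x i) - Q) \<le> \<rho> ((\<Sum>i<n. y i) - Q))"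
proof -
  have "continuous_on (minkowski_sum n S) (\<lambda>s. \<rho> (s - Q))"
    by (rule continuous_on_compose2[OF continuous[of UNIV]]) (auto intro!: continuous_intros)
  then obtain s where s: "s \<in> minkowski_sum n S" "\<And>t. t \<in> minkowski_sum n S \<Longrightarrow> \<rho> (s - Q) \<le> \<rho> (t - Q)"
    using minkowski_sum_compact[OF assms] continuous_attains_inf[of "minkowski_sum n S" "\<lambda>s. \<rho> (s - Q)"]
    unfolding nonempty_compacts_def by auto
  then obtain x where x: "s = (\<Sum>i<n. x i)" "\<forall>i<n. x i \<in> S i" unfolding minkowski_sum_def by auto
  have min: "\<rho> ((\<Sum>i<n. x i) - Q) \<le> \<rho> ((\<Sum>i<n. y i) - Q)" if "\<forall>i<n. y i \<in> S i" for y
    using s(2)[OF minkowski_sumI[of n y S]] that x(1) by blast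
  have "direct_cost (\<lambda>Q Q'. \<rho> (Q - Q')) n S Q = \<rho> ((\<Sum>i<n. x i) - Q)"
    unfolding direct_cost_def using x(2) min by (intro Least_equality) auto
  with x(2) min show ?thesis by blast
qed

lemma direct_cost_ge_dual:
  assumes S: "\<And>i. i < n \<Longrightarrow> S i \<in> nonempty_compacts" and z: "z \<in> polar \<rho>"
  shows "(\<Sum>i<n. min_support z (S i)) - z \<bullet> Q \<le> direct_cost (\<lambda>Q Q'. \<rho> (Q - Q')) n S Q"
proof -
  obtain x where x: "\<forall>i<n. x i \<in> S i"
    and cost: "direct_cost (\<lambda>Q Q'. \<rho> (Q - Q')) n S Q = \<rho> ((\<Sum>i<n. x i) - Q)"
    using direct_cost_attained[of n S Q, OF S] by blast
  have "(\<Sum>i<n. min_support z (S i)) \<le> (\<Sum>i<n. z \<bullet> x i)"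
    using min_support_le[OF S, of _ _ z] x by (intro sum_mono) (simp add: inner_commute[of z])
  then have "(\<Sum>i<n. min_support z (S i)) - z \<bullet> Q \<le> z \<bullet> ((\<Sum>i<n. x i) - Q)"
    by (simp add: inner_diff_right inner_sum_right)
  also have "\<dots> \<le> \<rho> ((\<Sum>i<n. x i) - Q)" using z unfolding polar_def by blast
  finally show ?thesis using cost by simp
qed

text \<open>With the convex hulls in place of the sets there is no gap: \<open>exists_dominated_functional\<close> gives a
  polar point \<open>w\<close> whose dual value is at least the relaxed optimum. Rounding the relaxed optimum costs
  at most \<open>L\<close> times the distance in \<open>greedy_rounding\<close>.\<close>

lemma direct_cost_duality_gap:
  assumes S: "\<And>i. i < n \<Longrightarrow> S i \<in> nonempty_compacts"
    and L: "\<And>x. \<rho> x \<le> L * norm x" "0 \<le> L"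
  shows "\<exists>w\<in>polar \<rho>. direct_cost (\<lambda>Q Q'. \<rho> (Q - Q')) n S Q
      \<le> (\<Sum>i<n. min_support w (S i)) - w \<bullet> Q + L * sqrt (\<Sum>i<n. (2 * set_norm (S i))\<^sup>2)"
proof -
  let ?C = "\<lambda>i. convex hull (S i)"
  have C: "?C i \<in> nonempty_compacts" if "i < n" for i
    using S[OF that] by (auto simp: nonempty_compacts_def compact_convex_hull)
  obtain x where x: "\<forall>i<n. x i \<in> ?C i"
    and x_min: "\<And>y. \<forall>i<n. y i \<in> ?C i \<Longrightarrow> \<rho> ((\<Sum>i<n. x i) - Q) \<le> \<rho> ((\<Sum>i<n. y i) - Q)"
    using direct_cost_attained[of n ?C Q, OF C] by blast
  let ?m = "\<rho> ((\<Sum>i<n. x i) - Q)"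
  let ?K = "(\<lambda>s. s - Q) ` minkowski_sum n ?C"
  have "?K = (\<lambda>s. (- Q) + s) ` minkowski_sum n ?C" by auto
  then have "convex ?K" using convex_translation[OF minkowski_sum_convex[of n ?C], of "- Q"] by simp
  moreover have "?K \<noteq> {}" using minkowski_sumI[of n x ?C] x by blast
  moreover have "?m \<le> \<rho> k" if "k \<in> ?K" for k
    using that x_min unfolding minkowski_sum_def by auto
  ultimately obtain w where w: "w \<in> polar \<rho>" "\<And>k. k \<in> ?K \<Longrightarrow> ?m \<le> w \<bullet> k"
    using exists_dominated_functional[of ?K ?m] by blast
  have "\<exists>y\<in>S i. y \<bullet> w = min_support w (S i)" if "i < n" for i
    using min_support_attained[OF S[OF that]] by metis
  then obtain y where y: "\<And>i. i < n \<Longrightarrow> y i \<in> S i" "\<And>i. i < n \<Longrightarrow> y i \<bullet> w = min_support w (S i)" by metis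
  \<comment> \<open>The minimisers over the sets themselves lie in the hulls, so the dual value involves only \<open>S\<close>.\<close>
  have "(\<Sum>i<n. y i) \<in> minkowski_sum n ?C" using y(1) by (intro minkowski_sumI hull_inc)
  then have "?m \<le> w \<bullet> ((\<Sum>i<n. y i) - Q)" using w(2) by blast
  also have "\<dots> = (\<Sum>i<n. min_support w (S i)) - w \<bullet> Q"
    using y(2) by (simp add: inner_diff_right inner_sum_right inner_commute)
  finally have m: "?m \<le> (\<Sum>i<n. min_support w (S i)) - w \<bullet> Q" .
  obtain q where q: "\<forall>i<n. q i \<in> S i"
    and close: "(norm (\<Sum>i<n. q i - x i))\<^sup>2 \<le> (\<Sum>i<n. (2 * set_norm (S i))\<^sup>2)"
    using greedy_rounding[of n x S "\<lambda>i. set_norm (S i)"] x norm_le_set_norm[OF S] by blast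
  obtain x' where "direct_cost (\<lambda>Q Q'. \<rho> (Q - Q')) n S Q = \<rho> ((\<Sum>i<n. x' i) - Q)"
    and "\<And>y. \<forall>i<n. y i \<in> S i \<Longrightarrow> \<rho> ((\<Sum>i<n. x' i) - Q) \<le> \<rho> ((\<Sum>i<n. y i) - Q)"
    using direct_cost_attained[of n S Q, OF S] by blast
  then have "direct_cost (\<lambda>Q Q'. \<rho> (Q - Q')) n S Q \<le> \<rho> ((\<Sum>i<n. q i) - Q)"
    using q by simp
  also have "(\<Sum>i<n. q i) - Q = ((\<Sum>i<n. x i) - Q) + (\<Sum>i<n. q i - x i)"
    by (simp add: sum_subtractf)
  also have "\<rho> \<dots> \<le> ?m + \<rho> (\<Sum>i<n. q i - x i)" by (rule subadditive)
  also have "\<rho> (\<Sum>i<n. q i - x i) \<le> L * norm (\<Sum>i<n. q i - x i)" by (rule L)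
  also have "\<dots> \<le> L * sqrt (\<Sum>i<n. (2 * set_norm (S i))\<^sup>2)"
    using close L(2) by (intro mult_left_mono real_le_rsqrt)
  finally show ?thesis using m w(1) by (intro bexI[of _ w]) auto
qed

end

section \<open>Averages of support functions\<close>

text \<open>The common Lipschitz constant transfers convergence from a finite net chosen in \<open>D\<close> to all of \<open>P\<close>. The
  bound on \<open>f n\<close> is only asked for eventually, because for averages of random sets the constant is
  controlled only in the limit.\<close>

lemma uniform_limit_of_lipschitz:
  fixes f :: "nat \<Rightarrow> 'a::metric_space \<Rightarrow> real"
  assumes lip_f: "\<forall>\<^sub>F n in sequentially. \<forall>x y. \<bar>f n x - f n y\<bar> \<le> B * dist x y"
    and lip_g: "\<And>x y. \<bar>g x - g y\<bar> \<le> B * dist x y"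
    and dense: "\<And>x \<delta>. 0 < \<delta> \<Longrightarrow> \<exists>d\<in>D. dist d x < \<delta>"
    and lim: "\<And>d. d \<in> D \<Longrightarrow> (\<lambda>n. f n d) \<longlonglongrightarrow> g d"
    and P: "compact P"
  shows "uniform_limit P f g sequentially"
  unfolding uniform_limit_iff
proof (intro allI impI)
  fix e :: real assume e: "0 < e"
  define \<delta> where "\<delta> = e / (3 * (\<bar>B\<bar> + 1))"
  have \<delta>: "0 < \<delta>" "\<bar>B\<bar> * \<delta> < e / 3" using e unfolding \<delta>_def by (auto simp: field_simps)
  have "P \<subseteq> (\<Union>d\<in>D. ball d \<delta>)" using dense[OF \<delta>(1)] by force
  then obtain k where k: "k \<subseteq> D" "finite k" "P \<subseteq> (\<Union>d\<in>k. ball d \<delta>)"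
    using compactE_image[OF P, of D "\<lambda>d. ball d \<delta>"] by auto
  have "\<forall>\<^sub>F n in sequentially. \<forall>d\<in>k. dist (f n d) (g d) < e / 3"
  proof (intro eventually_ball_finite[OF k(2)] ballI)
    fix d assume "d \<in> k"
    with k(1) have "d \<in> D" by blast
    from tendstoD[OF lim[OF this], of "e / 3"] e
    show "\<forall>\<^sub>F n in sequentially. dist (f n d) (g d) < e / 3" by simp
  qed
  with lip_f show "\<forall>\<^sub>F n in sequentially. \<forall>x\<in>P. dist (f n x) (g x) < e"
  proof eventually_elim
    case (elim n)
    show ?case
    proof
      fix x assume "x \<in> P"
      then obtain d where d: "d \<in> k" "dist d x < \<delta>" using k(3) by auto
      have "B * dist d x \<le> \<bar>B\<bar> * \<delta>" using d(2) by (intro mult_mono) auto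
      then have "B * dist d x < e / 3" using \<delta>(2) by simp
      then have "\<bar>f n d - f n x\<bar> < e / 3" "\<bar>g d - g x\<bar> < e / 3"
        using elim(1) lip_g[of d x] by (meson le_less_trans)+
      then show "dist (f n x) (g x) < e"
        using elim(2) d(1) unfolding dist_real_def abs_less_iff by fastforce
    qed
  qed
qed

text \<open>What almost every sample of the indifference sets satisfies, and all that the deterministic part of
  the argument needs to know about it.\<close>

locale averaging_sets =
  fixes S :: "nat \<Rightarrow> 'a::euclidean_space set" and H :: "'a \<Rightarrow> real" and c :: real
  assumes compact_sets: "\<And>i. S i \<in> nonempty_compacts"
    and norm_average: "(\<lambda>n. (\<Sum>i<n. set_norm (S i)) / real n) \<longlonglongrightarrow> c"
    and support_average: "\<And>P. compact P \<Longrightarrow>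
      uniform_limit P (\<lambda>n z. (\<Sum>i<n. min_support z (S i)) / real n) H sequentially"
begin

abbreviation H_avg :: "nat \<Rightarrow> 'a \<Rightarrow> real" where
  "H_avg n z \<equiv> (\<Sum>i<n. min_support z (S i)) / real n"

lemma H_avg_tendsto: "(\<lambda>n. H_avg n z) \<longlonglongrightarrow> H z"
  by (rule tendsto_uniform_limitI[OF support_average[of "{z}"]]) auto

text \<open>The mean of minimisers at \<open>p\<close> is a supergradient of \<open>H_avg n\<close> at \<open>p\<close>. Its component along \<open>v\<close> therefore lies
  between the difference quotients of \<open>H_avg n\<close> at \<open>p\<close> with steps \<open>t\<close> and \<open>- t\<close>. For fixed small \<open>t\<close> these converge
  to difference quotients of \<open>H\<close>, both close to the derivative along \<open>v\<close>.\<close>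

lemma price_response_converges:
  assumes diff: "H differentiable (at p)"
    and q: "\<And>i. q i \<in> S i" "\<And>i. q i \<bullet> p = min_support p (S i)"
  shows "(\<lambda>n. (\<Sum>i<n. q i) /\<^sub>R real n) \<longlonglongrightarrow> gradient H p"
proof -
  obtain F where F: "(H has_derivative F) (at p)" using diff unfolding differentiable_def by blast
  then have lin: "linear F" by (rule has_derivative_linear)
  define g where "g = (\<Sum>b\<in>Basis. F b *\<^sub>R b)"
  have F_eq: "F h = g \<bullet> h" for h
  proof -
    have "F h = F (\<Sum>b\<in>Basis. (h \<bullet> b) *\<^sub>R b)" by (simp add: euclidean_representation)
    also have "\<dots> = g \<bullet> h"
      unfolding g_def linear_sum[OF lin] linear_cmul[OF lin] inner_sum_left
      by (simp add: inner_commute mult.commute)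
    finally show ?thesis .
  qed
  have G: "GDERIV H p :> g"
    unfolding gderiv_def using F F_eq by (simp add: inner_commute[of _ g] ext[of F "\<lambda>h. g \<bullet> h", OF F_eq])
  have "gradient H p = g"
    unfolding gradient_def
  proof (rule the_equality, rule G)
    fix g' assume "GDERIV H p :> g'"
    then have "(\<lambda>h. h \<bullet> g') = (\<lambda>h. h \<bullet> g)"
      using G unfolding gderiv_def by (rule has_derivative_unique)
    then have "(g' - g) \<bullet> g' = (g' - g) \<bullet> g" by (rule fun_cong)
    then have "(g' - g) \<bullet> (g' - g) = 0" by (simp only: inner_diff_right diff_self)
    then show "g' = g" by simp
  qed
  moreover have "(\<lambda>n. (\<Sum>i<n. q i) /\<^sub>R real n) \<longlonglongrightarrow> g"
    unfolding tendsto_componentwise_iff[of _ g]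
  proof
    fix v :: 'a
    let ?q = "\<lambda>n. (\<Sum>i<n. q i) /\<^sub>R real n"
    have sup: "H_avg n z \<le> ?q n \<bullet> z" for n z
      using sum_mono[of "{..<n}" "\<lambda>i. min_support z (S i)" "\<lambda>i. q i \<bullet> z"] min_support_le[OF compact_sets q(1)]
      by (simp add: inner_sum_left divide_inverse mult.commute mult_left_mono)
    have at_p: "H_avg n p = ?q n \<bullet> p" for n
      by (simp add: inner_sum_left q(2) divide_inverse mult.commute)
    have slope: "H_avg n (p + t *\<^sub>R v) - H_avg n p \<le> t * (?q n \<bullet> v)" for n t
      using sup[where n = n and z = "p + t *\<^sub>R v"] unfolding at_p by (simp add: inner_add_right)
    have "((\<lambda>t. H (p + t *\<^sub>R v)) has_derivative (\<lambda>t. F (t *\<^sub>R v))) (at 0)"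
      by (rule has_derivative_compose[where f = "\<lambda>t. p + t *\<^sub>R v" and g = H])
        (auto intro!: derivative_eq_intros simp: F)
    then have "((\<lambda>t. H (p + t *\<^sub>R v)) has_field_derivative (g \<bullet> v)) (at 0)"
      unfolding has_field_derivative_def F_eq by (simp add: mult.commute[of "g \<bullet> v"] mult_commute_abs)
    then have der: "((\<lambda>t. (H (p + t *\<^sub>R v) - H p) / t) \<longlongrightarrow> g \<bullet> v) (at 0)"
      by (simp add: DERIV_def)
    show "(\<lambda>n. ?q n \<bullet> v) \<longlonglongrightarrow> g \<bullet> v"
    proof (rule LIMSEQ_I)
      fix r :: real assume r: "0 < r"
      obtain d where d: "0 < d" "\<And>t. t \<noteq> 0 \<Longrightarrow> \<bar>t\<bar> < d \<Longrightarrow> \<bar>(H (p + t *\<^sub>R v) - H p) / t - g \<bullet> v\<bar> < r"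
        using tendstoD[OF der r] unfolding eventually_at by (auto simp: dist_real_def)
      let ?D = "\<lambda>n t. (H_avg n (p + t *\<^sub>R v) - H_avg n p) / t"
      have D: "(\<lambda>n. ?D n t) \<longlonglongrightarrow> (H (p + t *\<^sub>R v) - H p) / t" if "t \<noteq> 0" for t
        by (intro tendsto_intros H_avg_tendsto that)
      let ?t = "d / 2"
      have "\<forall>\<^sub>F n in sequentially. g \<bullet> v - r < ?D n ?t"
        using d(2)[of ?t] d(1) by (intro order_tendstoD(1)[OF D]) auto
      moreover have "\<forall>\<^sub>F n in sequentially. ?D n (- ?t) < g \<bullet> v + r"
        using d(2)[of "- ?t"] d(1) by (intro order_tendstoD(2)[OF D]) auto
      ultimately have "\<forall>\<^sub>F n in sequentially. norm (?q n \<bullet> v - g \<bullet> v) < r"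
      proof eventually_elim
        case (elim n)
        have "?D n ?t \<le> ?q n \<bullet> v" using slope[where n = n and t = ?t] d(1) by (simp add: pos_divide_le_eq mult.commute)
        moreover have "?q n \<bullet> v \<le> ?D n (- ?t)"
        proof -
          have "- ?t < 0" using d(1) by simp
          then show ?thesis
            using slope[where n = n and t = "- ?t"] by (simp only: neg_le_divide_eq mult.commute)
        qed
        ultimately show ?case using elim by (simp add: abs_less_iff)
      qed
      then show "\<exists>N. \<forall>n\<ge>N. norm (?q n \<bullet> v - g \<bullet> v) < r" by (simp add: eventually_sequentially)
    qed
  qed
  ultimately show ?thesis by simp
qed

end

section \<open>Limits of the costs for a fixed sequence of sets\<close>

locale averaging_market = averaging_sets S H c + sublinear \<rho>
  for S :: "nat \<Rightarrow> 'a::euclidean_space set" and H c and \<rho> :: "'a \<Rightarrow> real"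
begin

lemma dual_maximum:
  "\<exists>z. is_arg_max (\<lambda>z. H z - z \<bullet> q\<^sub>0) (\<lambda>z. z \<in> polar \<rho>) z \<and> direct_limit \<rho> H q\<^sub>0 = H z - z \<bullet> q\<^sub>0"
proof -
  have "continuous_on (polar \<rho>) H"
  proof (rule uniform_limit_theorem[OF always_eventually support_average[OF compact_polar]], intro allI)
    show "continuous_on (polar \<rho>) (H_avg n)" for n
      unfolding divide_inverse by (intro continuous_intros continuous_on_min_support compact_sets)
  qed simp
  then have "continuous_on (polar \<rho>) (\<lambda>z. H z - z \<bullet> q\<^sub>0)" by (intro continuous_intros)
  then obtain z where z: "z \<in> polar \<rho>" "\<And>w. w \<in> polar \<rho> \<Longrightarrow> H w - w \<bullet> q\<^sub>0 \<le> H z - z \<bullet> q\<^sub>0"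
    using continuous_attains_sup[OF compact_polar polar_nonempty] by blast
  have "direct_limit \<rho> H q\<^sub>0 = H z - z \<bullet> q\<^sub>0"
    unfolding direct_limit_def using z by (intro Greatest_equality) auto
  with z show ?thesis unfolding is_arg_max_linorder by blast
qed

text \<open>The lower bound uses the dual value at a maximiser \<open>z\<close> of the limit problem. In the upper bound the
  dual point \<open>w\<close> varies with \<open>n\<close>; it stays in the compact polar, where \<open>H_avg n\<close> is uniformly close to \<open>H\<close>
  and \<open>w \<bullet> (Q n / n)\<close> is uniformly close to \<open>w \<bullet> q\<^sub>0\<close>.\<close>

lemma direct_cost_converges:
  assumes Q: "(\<lambda>n. Q n /\<^sub>R real n) \<longlonglongrightarrow> q\<^sub>0"
  shows "(\<lambda>n. direct_cost (\<lambda>Q Q'. \<rho> (Q - Q')) n S (Q n) / real n) \<longlonglongrightarrow> direct_limit \<rho> H q\<^sub>0"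
proof -
  let ?D = "\<lambda>n. direct_cost (\<lambda>Q Q'. \<rho> (Q - Q')) n S (Q n) / real n"
  let ?V = "direct_limit \<rho> H q\<^sub>0"
  obtain z where "is_arg_max (\<lambda>z. H z - z \<bullet> q\<^sub>0) (\<lambda>z. z \<in> polar \<rho>) z" and V: "?V = H z - z \<bullet> q\<^sub>0"
    using dual_maximum by blast
  then have z: "z \<in> polar \<rho>" and z_max: "\<And>w. w \<in> polar \<rho> \<Longrightarrow> H w - w \<bullet> q\<^sub>0 \<le> ?V"
    unfolding is_arg_max_linorder by auto
  obtain L where L: "0 \<le> L" "\<And>x. \<rho> x \<le> L * norm x" using linear_bound by blast
  obtain B where B: "\<And>w. w \<in> polar \<rho> \<Longrightarrow> norm w \<le> B"
    using compact_imp_bounded[OF compact_polar] unfolding bounded_iff by blast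
  let ?low = "\<lambda>n. H_avg n z - z \<bullet> (Q n /\<^sub>R real n)"
  have low: "?low n \<le> ?D n" for n
    using divide_right_mono[OF direct_cost_ge_dual[where S = S and n = n and Q = "Q n", OF compact_sets z], of "real n"]
    by (simp add: diff_divide_distrib divide_inverse mult.commute right_diff_distrib)
  have "?low \<longlonglongrightarrow> ?V" unfolding V by (intro tendsto_intros H_avg_tendsto Q)
  let ?gap = "\<lambda>n. L * (2 * sqrt ((\<Sum>i<n. (set_norm (S i))\<^sup>2) / (real n)\<^sup>2))"
  have "?gap \<longlonglongrightarrow> L * (2 * sqrt 0)"
    by (intro tendsto_mult tendsto_const tendsto_real_sqrt
        mean_square_vanishes[OF set_norm_nonneg[OF compact_sets] norm_average])
  then have gap: "?gap \<longlonglongrightarrow> 0" by simp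
  have up: "\<exists>w\<in>polar \<rho>. ?D n \<le> H_avg n w - w \<bullet> (Q n /\<^sub>R real n) + ?gap n" if "0 < n" for n
  proof -
    obtain w where w: "w \<in> polar \<rho>" "direct_cost (\<lambda>Q Q'. \<rho> (Q - Q')) n S (Q n)
      \<le> (\<Sum>i<n. min_support w (S i)) - w \<bullet> Q n + L * sqrt (\<Sum>i<n. (2 * set_norm (S i))\<^sup>2)"
      using direct_cost_duality_gap[where S = S and n = n and Q = "Q n", OF compact_sets L(2) L(1)] by blast
    let ?X = "sqrt (\<Sum>i<n. (2 * set_norm (S i))\<^sup>2)"
    have X: "?X / real n = 2 * sqrt ((\<Sum>i<n. (set_norm (S i))\<^sup>2) / (real n)\<^sup>2)"
      by (simp add: power_mult_distrib sum_distrib_left[symmetric] real_sqrt_mult real_sqrt_divide)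
    have "?D n \<le> ((\<Sum>i<n. min_support w (S i)) - w \<bullet> Q n + L * ?X) / real n"
      using w(2) by (rule divide_right_mono) simp
    also have "\<dots> = H_avg n w - w \<bullet> (Q n /\<^sub>R real n) + L * (?X / real n)"
      by (simp add: add_divide_distrib diff_divide_distrib divide_inverse_commute[of "w \<bullet> Q n"])
    finally show ?thesis using w(1) unfolding X by blast
  qed
  show ?thesis
  proof (rule LIMSEQ_I)
    fix r :: real assume r: "0 < r"
    have "\<forall>\<^sub>F n in sequentially. \<forall>w\<in>polar \<rho>. dist (H_avg n w) (H w) < r / 3"
      using uniform_limitD[OF support_average[OF compact_polar], of "r / 3"] r by simp
    moreover have "(\<lambda>n. B * norm (Q n /\<^sub>R real n - q\<^sub>0) + ?gap n) \<longlonglongrightarrow> B * norm (q\<^sub>0 - q\<^sub>0) + 0"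
      by (intro tendsto_intros Q gap)
    then have "\<forall>\<^sub>F n in sequentially. B * norm (Q n /\<^sub>R real n - q\<^sub>0) + ?gap n < r / 3"
      using r by (intro order_tendstoD(2)) auto
    moreover have "\<forall>\<^sub>F n in sequentially. ?V - r < ?low n"
      using order_tendstoD(1)[OF \<open>?low \<longlonglongrightarrow> ?V\<close>] r by simp
    ultimately have "\<forall>\<^sub>F n in sequentially. norm (?D n - ?V) < r"
      using eventually_gt_at_top[of 0]
    proof eventually_elim
      case (elim n)
      obtain w where w: "w \<in> polar \<rho>" "?D n \<le> H_avg n w - w \<bullet> (Q n /\<^sub>R real n) + ?gap n"
        using up[OF elim(4)] by blast
      have "- (w \<bullet> (Q n /\<^sub>R real n - q\<^sub>0)) \<le> norm w * norm (Q n /\<^sub>R real n - q\<^sub>0)"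
        using Cauchy_Schwarz_ineq2[of w "Q n /\<^sub>R real n - q\<^sub>0"] by linarith
      also have "\<dots> \<le> B * norm (Q n /\<^sub>R real n - q\<^sub>0)" by (intro mult_right_mono B w) simp
      finally have *: "- (w \<bullet> (Q n /\<^sub>R real n)) \<le> - (w \<bullet> q\<^sub>0) + B * norm (Q n /\<^sub>R real n - q\<^sub>0)"
        by (simp only: inner_diff_right)
      have "H_avg n w < H w + r / 3" using bspec[OF elim(1) w(1)] unfolding dist_real_def abs_less_iff by linarith
      then have "?D n < ?V + r" using w(2) * elim(2) z_max[OF w(1)] r by linarith
      moreover have "?V - r < ?D n" using elim(3) low[of n] by linarith
      ultimately show ?case by (simp add: abs_less_iff)
    qed
    then show "\<exists>N. \<forall>n\<ge>N. norm (?D n - ?V) < r" by (simp add: eventually_sequentially)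
  qed
qed

lemma price_cost_converges:
  assumes "H differentiable (at p)"
    and "\<And>i. q i \<in> S i" "\<And>i. q i \<bullet> p = min_support p (S i)"
    and Q: "(\<lambda>n. Q n /\<^sub>R real n) \<longlonglongrightarrow> q\<^sub>0"
  shows "(\<lambda>n. \<rho> ((\<Sum>i<n. q i) - Q n) / real n) \<longlonglongrightarrow> \<rho> (gradient H p - q\<^sub>0)"
proof -
  have "(\<lambda>n. (\<Sum>i<n. q i) /\<^sub>R real n - Q n /\<^sub>R real n) \<longlonglongrightarrow> gradient H p - q\<^sub>0"
    by (intro tendsto_diff Q price_response_converges assms)
  moreover have "isCont \<rho> (gradient H p - q\<^sub>0)"
    using continuous[of UNIV] by (simp add: continuous_on_eq_continuous_at)
  ultimately have "(\<lambda>n. \<rho> ((\<Sum>i<n. q i) /\<^sub>R real n - Q n /\<^sub>R real n)) \<longlonglongrightarrow> \<rho> (gradient H p - q\<^sub>0)"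
    by (rule isCont_tendsto_compose[rotated])
  moreover have "\<rho> ((\<Sum>i<n. q i) /\<^sub>R real n - Q n /\<^sub>R real n) = \<rho> ((\<Sum>i<n. q i) - Q n) / real n" for n
    using homogeneous[of "inverse (real n)" "(\<Sum>i<n. q i) - Q n"]
    by (simp add: scaleR_diff_right divide_inverse mult.commute)
  ultimately show ?thesis by simp
qed

end

section \<open>Random compact sets and the support function of their expectation\<close>

text \<open>A compact set meets a closed set \<open>F\<close> as soon as it meets every open neighbourhood of \<open>F\<close> of radius
  \<open>1 / (n + 1)\<close>, since disjoint such sets have positive distance.\<close>

lemma random_compact_set_hits_closed:
  fixes R :: "'w \<Rightarrow> 'a::euclidean_space set"
  assumes R: "random_compact_set M R" and F: "closed F"
  shows "{\<omega> \<in> space M. R \<omega> \<inter> F \<noteq> {}} \<in> sets M"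
proof -
  define U where "U = (\<lambda>n. \<Union>x\<in>F. ball x (inverse (real (Suc n))))"
  have "R \<omega> \<inter> F \<noteq> {}" if \<omega>: "\<omega> \<in> space M" and hit: "\<And>n. R \<omega> \<inter> U n \<noteq> {}" for \<omega>
  proof
    assume "R \<omega> \<inter> F = {}"
    moreover have "compact (R \<omega>)" using R \<omega> by (auto simp: random_compact_set_def nonempty_compacts_def)
    ultimately obtain \<delta> where \<delta>: "0 < \<delta>" "\<And>x y. x \<in> R \<omega> \<Longrightarrow> y \<in> F \<Longrightarrow> \<delta> \<le> dist x y"
      using separate_compact_closed[OF _ F] by metis
    obtain n where n: "inverse (real (Suc n)) < \<delta>" using reals_Archimedean[OF \<delta>(1)] by blast
    obtain x y where "x \<in> R \<omega>" "y \<in> F" "dist y x < inverse (real (Suc n))"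
      using hit[of n] unfolding U_def by auto
    with \<delta>(2)[of x y] n show False by (simp add: dist_commute)
  qed
  moreover have "F \<subseteq> U n" for n unfolding U_def by force
  ultimately have "{\<omega> \<in> space M. R \<omega> \<inter> F \<noteq> {}} = {\<omega> \<in> space M. \<forall>n. R \<omega> \<inter> U n \<noteq> {}}" by blast
  moreover have "{\<omega> \<in> space M. R \<omega> \<inter> U n \<noteq> {}} \<in> sets M" for n
  proof -
    have "open (U n)" unfolding U_def by blast
    then show ?thesis using R unfolding random_compact_set_def by blast
  qed
  ultimately show ?thesis using sets.sets_Collect_countable_All by simp
qed

lemma min_support_less_iff:
  assumes "C \<in> nonempty_compacts"
  shows "min_support p C < y \<longleftrightarrow> C \<inter> {x. x \<bullet> p < y} \<noteq> {}"
proof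
  assume y: "min_support p C < y"
  obtain x where "x \<in> C" "x \<bullet> p = min_support p C" using min_support_attained[OF assms] by metis
  with y show "C \<inter> {x. x \<bullet> p < y} \<noteq> {}" by auto
next
  assume "C \<inter> {x. x \<bullet> p < y} \<noteq> {}"
  then show "min_support p C < y" using min_support_le[OF assms, of _ p] by fastforce
qed

lemma borel_measurable_min_support:
  assumes R: "random_compact_set M R"
  shows "(\<lambda>\<omega>. min_support p (R \<omega>)) \<in> borel_measurable M"
proof (rule borel_measurableI_less)
  fix y
  have "open {x. x \<bullet> p < y}" by (intro open_Collect_less continuous_intros)
  then have "{\<omega> \<in> space M. R \<omega> \<inter> {x. x \<bullet> p < y} \<noteq> {}} \<in> sets M"
    using R unfolding random_compact_set_def by blast
  moreover have "{\<omega> \<in> space M. R \<omega> \<inter> {x. x \<bullet> p < y} \<noteq> {}} = {\<omega> \<in> space M. min_support p (R \<omega>) < y}"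
    using R min_support_less_iff[of "R _" p y] unfolding random_compact_set_def by blast
  ultimately show "{\<omega> \<in> space M. min_support p (R \<omega>) < y} \<in> sets M" by simp
qed

lemma borel_measurable_set_norm:
  fixes R :: "'w \<Rightarrow> 'a::euclidean_space set"
  assumes R: "random_compact_set M R"
  shows "(\<lambda>\<omega>. set_norm (R \<omega>)) \<in> borel_measurable M"
proof (rule borel_measurableI_greater)
  fix y
  have "open {x::'a. y < norm x}" by (intro open_Collect_less continuous_intros)
  then have "{\<omega> \<in> space M. R \<omega> \<inter> {x. y < norm x} \<noteq> {}} \<in> sets M"
    using R unfolding random_compact_set_def by blast
  moreover have "R \<omega> \<inter> {x. y < norm x} \<noteq> {} \<longleftrightarrow> y < set_norm (R \<omega>)" if "\<omega> \<in> space M" for \<omega>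
  proof -
    have C: "R \<omega> \<in> nonempty_compacts" using R that unfolding random_compact_set_def by blast
    then have "bdd_above (norm ` R \<omega>)" using norm_le_set_norm by (auto intro!: bdd_aboveI)
    moreover have "R \<omega> \<noteq> {}" using C unfolding nonempty_compacts_def by blast
    ultimately show ?thesis unfolding set_norm_def by (subst less_cSUP_iff) auto
  qed
  then have "{\<omega> \<in> space M. R \<omega> \<inter> {x. y < norm x} \<noteq> {}} = {\<omega> \<in> space M. y < set_norm (R \<omega>)}" by blast
  ultimately show "{\<omega> \<in> space M. y < set_norm (R \<omega>)} \<in> sets M" by simp
qed

text \<open>The minimisers of \<open>b\<close> meet a closed set \<open>F\<close> if and only if, for every rational \<open>r\<close> above the minimum, \<open>R \<omega>\<close>
  meets the closed set of those points of \<open>F\<close> at which \<open>b\<close> takes values up to \<open>r\<close>. Open sets are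
  countable unions of closed boxes.\<close>

lemma random_compact_set_argmin:
  fixes R :: "'w \<Rightarrow> 'a::euclidean_space set"
  assumes R: "random_compact_set M R"
  shows "random_compact_set M (\<lambda>\<omega>. {x \<in> R \<omega>. x \<bullet> b = min_support b (R \<omega>)})"
proof -
  let ?A = "\<lambda>\<omega>. {x \<in> R \<omega>. x \<bullet> b = min_support b (R \<omega>)}"
  have C: "R \<omega> \<in> nonempty_compacts" if "\<omega> \<in> space M" for \<omega>
    using R that unfolding random_compact_set_def by blast
  note [measurable] = borel_measurable_min_support[OF R]
  have closed_hit: "{\<omega> \<in> space M. ?A \<omega> \<inter> F \<noteq> {}} \<in> sets M" if F: "closed F" for F
  proof -
    let ?F = "\<lambda>r. F \<inter> {x. x \<bullet> b \<le> r}"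
    have cl: "closed (?F r)" for r by (intro closed_Int F closed_Collect_le continuous_intros)
    have "?A \<omega> \<inter> F \<noteq> {} \<longleftrightarrow> (\<forall>r\<in>\<rat>. min_support b (R \<omega>) < r \<longrightarrow> R \<omega> \<inter> ?F r \<noteq> {})"
      if \<omega>: "\<omega> \<in> space M" for \<omega>
    proof
      assume "?A \<omega> \<inter> F \<noteq> {}"
      then show "\<forall>r\<in>\<rat>. min_support b (R \<omega>) < r \<longrightarrow> R \<omega> \<inter> ?F r \<noteq> {}" by fastforce
    next
      assume hit: "\<forall>r\<in>\<rat>. min_support b (R \<omega>) < r \<longrightarrow> R \<omega> \<inter> ?F r \<noteq> {}"
      obtain r\<^sub>0 where "r\<^sub>0 \<in> \<rat>" "min_support b (R \<omega>) < r\<^sub>0"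
        using Rats_dense_in_real[of "min_support b (R \<omega>)" "min_support b (R \<omega>) + 1"] by auto
      with hit have "R \<omega> \<inter> F \<noteq> {}" by blast
      moreover have "compact (R \<omega> \<inter> F)"
        using C[OF \<omega>] F by (auto simp: nonempty_compacts_def intro: compact_Int_closed)
      ultimately have K: "R \<omega> \<inter> F \<in> nonempty_compacts" by (simp add: nonempty_compacts_def)
      then obtain x where x: "x \<in> R \<omega> \<inter> F" "\<And>y. y \<in> R \<omega> \<inter> F \<Longrightarrow> x \<bullet> b \<le> y \<bullet> b"
        using min_support_attained[OF K, of b] by metis
      have "x \<bullet> b \<le> min_support b (R \<omega>)"
      proof (rule ccontr)
        assume "\<not> ?thesis"
        then obtain r where r: "r \<in> \<rat>" "min_support b (R \<omega>) < r" "r < x \<bullet> b"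
          using Rats_dense_in_real by (metis not_le)
        with hit obtain y where "y \<in> R \<omega> \<inter> F" "y \<bullet> b \<le> r" by blast
        with x(2) r(3) show False by fastforce
      qed
      then have "x \<bullet> b = min_support b (R \<omega>)" using min_support_le[OF C[OF \<omega>], of x b] x(1) by simp
      with x(1) show "?A \<omega> \<inter> F \<noteq> {}" by blast
    qed
    then have "{\<omega> \<in> space M. ?A \<omega> \<inter> F \<noteq> {}}
        = {\<omega> \<in> space M. \<forall>r\<in>\<rat>. min_support b (R \<omega>) < r \<longrightarrow> R \<omega> \<inter> ?F r \<noteq> {}}" by blast
    also have "\<dots> \<in> sets M"
    proof (intro sets.sets_Collect_countable_All' countable_rat)
      fix r :: real
      have [measurable]: "Measurable.pred M (\<lambda>\<omega>. R \<omega> \<inter> ?F r \<noteq> {})"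
        using random_compact_set_hits_closed[OF R cl] by (simp add: pred_def)
      show "{\<omega> \<in> space M. min_support b (R \<omega>) < r \<longrightarrow> R \<omega> \<inter> ?F r \<noteq> {}} \<in> sets M" by measurable
    qed
    finally show ?thesis .
  qed
  have "{\<omega> \<in> space M. ?A \<omega> \<inter> U \<noteq> {}} \<in> sets M" if U: "open U" for U
  proof -
    obtain D where D: "countable D" "\<And>F. F \<in> D \<Longrightarrow> \<exists>a b. F = cbox a b" "\<Union>D = U"
      using open_countable_Union_open_cbox[OF U] by metis
    have "{\<omega> \<in> space M. ?A \<omega> \<inter> U \<noteq> {}} = {\<omega> \<in> space M. \<exists>F\<in>D. ?A \<omega> \<inter> F \<noteq> {}}"
      unfolding D(3)[symmetric] by blast
    also have "\<dots> \<in> sets M"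
      using D(2) by (intro sets.sets_Collect_countable_Ex' closed_hit D(1)) (auto simp: closed_cbox)
    finally show ?thesis .
  qed
  moreover have "?A \<omega> \<in> nonempty_compacts" if \<omega>: "\<omega> \<in> space M" for \<omega>
  proof -
    have "compact (R \<omega> \<inter> {x. x \<bullet> b = min_support b (R \<omega>)})"
      using C[OF \<omega>] unfolding nonempty_compacts_def
      by (intro compact_Int_closed closed_Collect_eq continuous_intros) auto
    moreover have "R \<omega> \<inter> {x. x \<bullet> b = min_support b (R \<omega>)} = ?A \<omega>" by blast
    moreover obtain x where "x \<in> R \<omega>" "x \<bullet> b = min_support b (R \<omega>)"
      using min_support_attained[OF C[OF \<omega>]] by metis
    then have "?A \<omega> \<noteq> {}" by blast
    ultimately show ?thesis unfolding nonempty_compacts_def by simp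
  qed
  ultimately show ?thesis unfolding random_compact_set_def by blast
qed

text \<open>Minimising the vectors of \<open>bs\<close> one after the other leaves sets on which each of them is constant.
  When \<open>bs\<close> is a basis, these sets are singletons, which gives a measurable selection.\<close>

lemma random_compact_set_lexicographic:
  fixes R :: "'w \<Rightarrow> 'a::euclidean_space set"
  assumes "random_compact_set M R"
  shows "\<exists>T. random_compact_set M T \<and> (\<forall>\<omega>. T \<omega> \<subseteq> R \<omega>)
    \<and> (\<forall>\<omega>. \<forall>b\<in>set bs. \<forall>x\<in>T \<omega>. \<forall>y\<in>T \<omega>. x \<bullet> b = y \<bullet> b)"
proof (induction bs)
  case Nil
  then show ?case using assms by auto
next
  case (Cons b bs)
  then obtain T where T: "random_compact_set M T" "\<And>\<omega>. T \<omega> \<subseteq> R \<omega>"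
    "\<And>\<omega> b x y. b \<in> set bs \<Longrightarrow> x \<in> T \<omega> \<Longrightarrow> y \<in> T \<omega> \<Longrightarrow> x \<bullet> b = y \<bullet> b" by blast
  let ?T = "\<lambda>\<omega>. {x \<in> T \<omega>. x \<bullet> b = min_support b (T \<omega>)}"
  have "random_compact_set M ?T" by (rule random_compact_set_argmin[OF T(1)])
  moreover have "?T \<omega> \<subseteq> R \<omega>" for \<omega> using T(2) by blast
  moreover have "x \<bullet> b' = y \<bullet> b'" if "b' \<in> set (b # bs)" "x \<in> ?T \<omega>" "y \<in> ?T \<omega>" for \<omega> b' x y
    using that T(3)[of b' x \<omega> y] by auto
  ultimately show ?case by blast
qed

lemma measurable_argmin:
  fixes R :: "'w \<Rightarrow> 'a::euclidean_space set"
  assumes R: "random_compact_set M R"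
  obtains X where "X \<in> borel_measurable M"
    and "\<And>\<omega>. \<omega> \<in> space M \<Longrightarrow> X \<omega> \<in> R \<omega>" "\<And>\<omega>. \<omega> \<in> space M \<Longrightarrow> X \<omega> \<bullet> p = min_support p (R \<omega>)"
proof -
  obtain bs :: "'a list" where bs: "set bs = Basis" using finite_list[OF finite_Basis] by blast
  obtain T where T: "random_compact_set M T" "\<And>\<omega>. T \<omega> \<subseteq> {x \<in> R \<omega>. x \<bullet> p = min_support p (R \<omega>)}"
    "\<And>\<omega> b x y. b \<in> Basis \<Longrightarrow> x \<in> T \<omega> \<Longrightarrow> y \<in> T \<omega> \<Longrightarrow> x \<bullet> b = y \<bullet> b"
    using random_compact_set_lexicographic[OF random_compact_set_argmin[OF R, of p], of bs] unfolding bs by blast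
  define X where "X = (\<lambda>\<omega>. SOME x. x \<in> T \<omega>)"
  have C: "T \<omega> \<in> nonempty_compacts" if "\<omega> \<in> space M" for \<omega>
    using T(1) that unfolding random_compact_set_def by blast
  have X: "X \<omega> \<in> T \<omega>" if "\<omega> \<in> space M" for \<omega>
    unfolding X_def some_in_eq using C[OF that] by (simp add: nonempty_compacts_def)
  have "(\<lambda>\<omega>. X \<omega> \<bullet> b) \<in> borel_measurable M" if b: "b \<in> Basis" for b
  proof -
    \<comment> \<open>All points of \<open>T \<omega>\<close> have the same coordinates, so each coordinate of \<open>X\<close> is a support function.\<close>
    have "min_support b (T \<omega>) = X \<omega> \<bullet> b" if "\<omega> \<in> space M" for \<omega>
      by (rule min_support_eqI[OF X[OF that]]) (simp add: T(3)[OF b X[OF that]])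
    then show ?thesis using borel_measurable_min_support[OF T(1), of b]
      by (simp cong: measurable_cong)
  qed
  then have "X \<in> borel_measurable M" by (rule borel_measurable_euclidean_space[THEN iffD2, OF ballI])
  moreover have "X \<omega> \<in> R \<omega>" "X \<omega> \<bullet> p = min_support p (R \<omega>)" if "\<omega> \<in> space M" for \<omega>
    using X[OF that] T(2)[of \<omega>] by auto
  ultimately show thesis using that by blast
qed

lemma integrable_min_support:
  assumes R: "random_compact_set M R" and int: "integrable M (\<lambda>\<omega>. set_norm (R \<omega>))"
  shows "integrable M (\<lambda>\<omega>. min_support p (R \<omega>))"
proof (rule Bochner_Integration.integrable_bound)
  show "integrable M (\<lambda>\<omega>. set_norm (R \<omega>) * norm p)" using int by simp
  show "AE \<omega> in M. norm (min_support p (R \<omega>)) \<le> norm (set_norm (R \<omega>) * norm p)"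
  proof (rule AE_I2)
    fix \<omega> assume "\<omega> \<in> space M"
    then have "R \<omega> \<in> nonempty_compacts" using R unfolding random_compact_set_def by blast
    from abs_min_support_le[OF this, of p]
    show "norm (min_support p (R \<omega>)) \<le> norm (set_norm (R \<omega>) * norm p)"
      unfolding real_norm_def using abs_ge_self order_trans by blast
  qed
qed (rule borel_measurable_min_support[OF R])

text \<open>Every selection has expected value along \<open>p\<close> at least the integral, and a measurable selection of
  minimisers attains it.\<close>

lemma min_support_set_expectation:
  assumes R: "random_compact_set M R" and int: "integrable M (\<lambda>\<omega>. set_norm (R \<omega>))"
  shows "min_support p (set_expectation M R) = (\<integral>\<omega>. min_support p (R \<omega>) \<partial>M)"
proof -
  have C: "R \<omega> \<in> nonempty_compacts" if "\<omega> \<in> space M" for \<omega>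
    using R that unfolding random_compact_set_def by blast
  obtain X where [measurable]: "X \<in> borel_measurable M"
    and X: "\<And>\<omega>. \<omega> \<in> space M \<Longrightarrow> X \<omega> \<in> R \<omega>" "\<And>\<omega>. \<omega> \<in> space M \<Longrightarrow> X \<omega> \<bullet> p = min_support p (R \<omega>)"
    using measurable_argmin[OF R] by blast
  have "integrable M X"
    using int
  proof (rule Bochner_Integration.integrable_bound)
    show "AE \<omega> in M. norm (X \<omega>) \<le> norm (set_norm (R \<omega>))"
    proof (rule AE_I2)
      fix \<omega> assume "\<omega> \<in> space M"
      from norm_le_set_norm[OF C X(1), OF this this]
      show "norm (X \<omega>) \<le> norm (set_norm (R \<omega>))"
        unfolding real_norm_def using abs_ge_self order_trans by blast
    qed
  qed simp
  then have sel: "selection M R X" unfolding selection_def using X(1) by auto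
  have "(\<integral>\<omega>. min_support p (R \<omega>) \<partial>M) = (\<integral>\<omega>. X \<omega> \<bullet> p \<partial>M)"
    by (intro Bochner_Integration.integral_cong) (auto simp: X(2))
  also have "\<dots> = integral\<^sup>L M X \<bullet> p" using \<open>integrable M X\<close> by simp
  finally have eq: "(\<integral>\<omega>. min_support p (R \<omega>) \<partial>M) = integral\<^sup>L M X \<bullet> p" .
  show ?thesis unfolding eq
  proof (rule min_support_eqI)
    show "integral\<^sup>L M X \<in> set_expectation M R" unfolding set_expectation_def using sel by blast
    fix y assume "y \<in> set_expectation M R"
    then obtain Y where y: "y = integral\<^sup>L M Y" and Y: "integrable M Y" "AE \<omega> in M. Y \<omega> \<in> R \<omega>"
      unfolding set_expectation_def selection_def by blast
    have "(\<integral>\<omega>. min_support p (R \<omega>) \<partial>M) \<le> (\<integral>\<omega>. Y \<omega> \<bullet> p \<partial>M)"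
    proof (rule integral_mono_AE[OF integrable_min_support[OF R int]])
      show "integrable M (\<lambda>\<omega>. Y \<omega> \<bullet> p)" using Y(1) by simp
      show "AE \<omega> in M. min_support p (R \<omega>) \<le> Y \<omega> \<bullet> p"
        using Y(2) AE_space by eventually_elim (rule min_support_le[OF C])
    qed
    also have "\<dots> = y \<bullet> p" unfolding y using Y(1) by simp
    finally show "integral\<^sup>L M X \<bullet> p \<le> y \<bullet> p" using eq by simp
  qed
qed

section \<open>Almost sure convergence\<close>

lemma (in prob_space) averages_of_iid_copies:
  fixes f :: "'b \<Rightarrow> real"
  assumes ind: "indep_vars (\<lambda>_. K) X UNIV"
    and law: "\<And>i. distr M K (X i) = distr M' K Y" and Y: "Y \<in> measurable M' K"
    and f[measurable]: "f \<in> borel_measurable K" and int: "integrable M' (\<lambda>\<omega>. f (Y \<omega>))"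
  shows "AE \<omega> in M. (\<lambda>n. (\<Sum>i<n. f (X i \<omega>)) / real n) \<longlonglongrightarrow> (\<integral>\<omega>. f (Y \<omega>) \<partial>M')"
proof -
  have X: "X i \<in> measurable M K" for i using ind unfolding indep_vars_def2 by blast
  have "distr M borel (\<lambda>\<omega>. f (X i \<omega>)) = distr (distr M K (X i)) borel f" for i
    using X by (simp add: distr_distr comp_def)
  then have "distr M borel (\<lambda>\<omega>. f (X i \<omega>)) = distr (distr M' K Y) borel f" for i
    unfolding law .
  then have id: "distr M borel (\<lambda>\<omega>. f (X i \<omega>)) = distr M borel (\<lambda>\<omega>. f (X 0 \<omega>))" for i
    by simp
  have "integrable (distr M' K Y) f" using int Y by (simp add: integrable_distr_eq)
  then have int0: "integrable M (\<lambda>\<omega>. f (X 0 \<omega>))"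
    unfolding law[of 0, symmetric] using X by (simp add: integrable_distr_eq)
  have "expectation (\<lambda>\<omega>. f (X 0 \<omega>)) = integral\<^sup>L (distr M K (X 0)) f" using X by (simp add: integral_distr)
  also have "\<dots> = (\<integral>\<omega>. f (Y \<omega>) \<partial>M')" unfolding law using Y by (simp add: integral_distr)
  finally have E: "expectation (\<lambda>\<omega>. f (X 0 \<omega>)) = (\<integral>\<omega>. f (Y \<omega>) \<partial>M')" .
  show ?thesis
    using strong_law_of_large_numbers[OF indep_vars_compose2[OF ind, where Y = "\<lambda>_. f" and N = "\<lambda>_. borel"] id int0]
    unfolding E by simp
qed

text \<open>The strong law is applied at the points of a countable dense set and to the norms, which costs only
  countably many null sets. The Lipschitz constants of the averages tend to the mean norm, hence are
  eventually below the mean norm plus one, a constant that also serves for the limit.\<close>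

lemma (in prob_space) AE_averaging_sets:
  fixes R :: "'w \<Rightarrow> 'b::euclidean_space set" and Rs :: "nat \<Rightarrow> 'a \<Rightarrow> 'b set"
  assumes R: "random_compact_set M' R" and int: "integrable M' (\<lambda>\<omega>. set_norm (R \<omega>))"
    and ind: "indep_vars (\<lambda>_. compacts_algebra) Rs UNIV"
    and law: "\<And>i. distr M compacts_algebra (Rs i) = distr M' compacts_algebra R"
  shows "AE \<omega> in M. averaging_sets (\<lambda>i. Rs i \<omega>)
    (\<lambda>z. \<integral>\<omega>. min_support z (R \<omega>) \<partial>M') (\<integral>\<omega>. set_norm (R \<omega>) \<partial>M')"
proof -
  let ?H = "\<lambda>z. \<integral>\<omega>. min_support z (R \<omega>) \<partial>M'" and ?c = "\<integral>\<omega>. set_norm (R \<omega>) \<partial>M'"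
  have id: "random_compact_set (compacts_algebra :: 'b set measure) (\<lambda>C. C)"
    unfolding random_compact_set_iff_measurable by simp
  have R_meas: "R \<in> measurable M' compacts_algebra" using R random_compact_set_iff_measurable by blast
  have Rs: "random_compact_set M (Rs i)" for i
    unfolding random_compact_set_iff_measurable using ind unfolding indep_vars_def2 by blast
  obtain D :: "'b set" where D: "countable D" "\<And>U. open U \<Longrightarrow> U \<noteq> {} \<Longrightarrow> \<exists>d\<in>D. d \<in> U"
    using countable_dense_exists by metis
  have norms: "AE \<omega> in M. (\<lambda>n. (\<Sum>i<n. set_norm (Rs i \<omega>)) / real n) \<longlonglongrightarrow> ?c"
    by (rule averages_of_iid_copies[OF ind law R_meas borel_measurable_set_norm[OF id] int])
  have supports: "AE \<omega> in M. \<forall>z\<in>D. (\<lambda>n. (\<Sum>i<n. min_support z (Rs i \<omega>)) / real n) \<longlonglongrightarrow> ?H z"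
    unfolding AE_ball_countable[OF D(1)]
    using averages_of_iid_copies[OF ind law R_meas borel_measurable_min_support[OF id]
        integrable_min_support[OF R int]] by blast
  have lip_H: "\<bar>?H x - ?H y\<bar> \<le> (?c + 1) * dist x y" for x y
  proof -
    have "\<bar>?H x - ?H y\<bar> = \<bar>\<integral>\<omega>. min_support x (R \<omega>) - min_support y (R \<omega>) \<partial>M'\<bar>"
      using integrable_min_support[OF R int] by (simp add: Bochner_Integration.integral_diff)
    also have "\<dots> \<le> (\<integral>\<omega>. \<bar>min_support x (R \<omega>) - min_support y (R \<omega>)\<bar> \<partial>M')"
      by (rule integral_abs_bound)
    also have "\<dots> \<le> (\<integral>\<omega>. set_norm (R \<omega>) * dist x y \<partial>M')"
    proof (rule integral_mono)
      fix \<omega> assume "\<omega> \<in> space M'"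
      then have "R \<omega> \<in> nonempty_compacts" using R unfolding random_compact_set_def by blast
      then show "\<bar>min_support x (R \<omega>) - min_support y (R \<omega>)\<bar> \<le> set_norm (R \<omega>) * dist x y"
        unfolding dist_norm by (rule min_support_lipschitz)
    qed (use int integrable_min_support[OF R int] in auto)
    also have "\<dots> = ?c * dist x y" by simp
    also have "\<dots> \<le> (?c + 1) * dist x y" by (intro mult_right_mono) auto
    finally show ?thesis .
  qed
  from norms supports AE_space show ?thesis
  proof eventually_elim
    case (elim \<omega>)
    have C: "Rs i \<omega> \<in> nonempty_compacts" for i
      using Rs[of i] elim(3) unfolding random_compact_set_def by blast
    have "\<forall>\<^sub>F n in sequentially. (\<Sum>i<n. set_norm (Rs i \<omega>)) / real n < ?c + 1"
      using elim(1) by (rule order_tendstoD) simp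
    then have lip: "\<forall>\<^sub>F n in sequentially. \<forall>x y.
        \<bar>(\<Sum>i<n. min_support x (Rs i \<omega>)) / real n - (\<Sum>i<n. min_support y (Rs i \<omega>)) / real n\<bar>
        \<le> (?c + 1) * dist x y"
    proof eventually_elim
      case (elim n)
      show ?case
      proof (intro allI)
        fix x y :: 'b
        have "\<bar>(\<Sum>i<n. min_support x (Rs i \<omega>)) - (\<Sum>i<n. min_support y (Rs i \<omega>))\<bar>
            \<le> (\<Sum>i<n. set_norm (Rs i \<omega>) * dist x y)"
          unfolding sum_subtractf[symmetric] dist_norm
          by (intro sum_abs[THEN order_trans] sum_mono min_support_lipschitz C)
        then have "\<bar>(\<Sum>i<n. min_support x (Rs i \<omega>)) - (\<Sum>i<n. min_support y (Rs i \<omega>))\<bar> / real n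
            \<le> (\<Sum>i<n. set_norm (Rs i \<omega>)) / real n * dist x y"
          using divide_right_mono[of _ _ "real n"] by (fastforce simp: sum_distrib_right)
        also have "\<dots> \<le> (?c + 1) * dist x y" using elim by (intro mult_right_mono) auto
        finally show "\<bar>(\<Sum>i<n. min_support x (Rs i \<omega>)) / real n - (\<Sum>i<n. min_support y (Rs i \<omega>)) / real n\<bar>
            \<le> (?c + 1) * dist x y" by (simp add: diff_divide_distrib[symmetric])
      qed
    qed
    show ?case
    proof (unfold_locales)
      fix P :: "'b set" assume P: "compact P"
      show "uniform_limit P (\<lambda>n z. (\<Sum>i<n. min_support z (Rs i \<omega>)) / real n) ?H sequentially"
      proof (rule uniform_limit_of_lipschitz[OF lip lip_H _ _ P])
        show "\<exists>d\<in>D. dist d x < \<delta>" if "0 < \<delta>" for x \<delta>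
          using D(2)[of "ball x \<delta>"] that by (auto simp: dist_commute)
      qed (use elim(2) in blast)
    qed (use C elim(1) in auto)
  qed
qed

theorem theorem3:
  fixes M :: "'w measure" and R :: "'w \<Rightarrow> (real ^ 'd) set"
    and N :: "'v measure" and Rs :: "nat \<Rightarrow> 'v \<Rightarrow> (real ^ 'd) set"
    and \<sigma> :: "real ^ 'd \<Rightarrow> real ^ 'd \<Rightarrow> real" and \<rho> :: "real ^ 'd \<Rightarrow> real"
    and Q\<^sub>0 :: "nat \<Rightarrow> 'v \<Rightarrow> real ^ 'd" and q\<^sub>0 :: "real ^ 'd"
    and q :: "nat \<Rightarrow> real ^ 'd \<Rightarrow> 'v \<Rightarrow> real ^ 'd"
    and H :: "real ^ 'd \<Rightarrow> real"
  assumes "prob_space M" and "non_atomic M"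
    and "random_compact_set M R" and "integrable M (\<lambda>\<omega>. set_norm (R \<omega>))"
    and "prob_space N"
    and "prob_space.indep_vars N (\<lambda>_. compacts_algebra) Rs UNIV"
    and "\<And>i. distr N compacts_algebra (Rs i) = distr M compacts_algebra R"
    and "\<And>Q Q'. \<sigma> Q Q' = \<rho> (Q - Q')"
    and "convex_on UNIV \<rho>" and "\<And>\<alpha> x. \<alpha> \<ge> 0 \<Longrightarrow> \<rho> (\<alpha> *\<^sub>R x) = \<alpha> * \<rho> x"
    and "\<And>n. Q\<^sub>0 n \<in> borel_measurable N"
    and "AE \<omega> in N. (\<lambda>n. Q\<^sub>0 n \<omega> /\<^sub>R real n) \<longlonglongrightarrow> q\<^sub>0"
    and "\<And>i p \<omega>. \<omega> \<in> space N \<Longrightarrow> is_arg_min (\<lambda>x. p \<bullet> x) (\<lambda>x. x \<in> Rs i \<omega>) (q i p \<omega>)"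
    and "H = (\<lambda>p. min_support p (set_expectation M R))"
  shows "(\<forall>n. \<forall>\<omega>\<in>space N. \<exists>x. is_arg_min (\<lambda>x. \<sigma> (\<Sum>i<n. x i) (Q\<^sub>0 n \<omega>)) (\<lambda>x. \<forall>i<n. x i \<in> Rs i \<omega>) x)
    \<and> (\<exists>z. is_arg_max (\<lambda>z. H z - z \<bullet> q\<^sub>0) (\<lambda>z. z \<in> polar \<rho>) z)
    \<and> (AE \<omega> in N. (\<lambda>n. direct_cost \<sigma> n (\<lambda>i. Rs i \<omega>) (Q\<^sub>0 n \<omega>) / real n) \<longlonglongrightarrow> direct_limit \<rho> H q\<^sub>0)
    \<and> (\<forall>p. H differentiable (at p) \<longrightarrow>
         (AE \<omega> in N. (\<lambda>n. \<sigma> (\<Sum>i<n. q i p \<omega>) (Q\<^sub>0 n \<omega>) / real n) \<longlonglongrightarrow> \<rho> (gradient H p - q\<^sub>0)))"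
proof -
  interpret N: prob_space N by fact
  interpret sublinear \<rho> by unfold_locales fact+
  let ?c = "\<integral>\<omega>. set_norm (R \<omega>) \<partial>M"
  have H: "H = (\<lambda>z. \<integral>\<omega>. min_support z (R \<omega>) \<partial>M)"
    unfolding assms(14) min_support_set_expectation[OF assms(3,4)] ..
  have \<sigma>: "\<sigma> = (\<lambda>Q Q'. \<rho> (Q - Q'))" using assms(8) by (intro ext)
  have "random_compact_set N (Rs i)" for i
    unfolding random_compact_set_iff_measurable using assms(6) unfolding N.indep_vars_def2 by blast
  then have C: "Rs i \<omega> \<in> nonempty_compacts" if "\<omega> \<in> space N" for i \<omega>
    using that unfolding random_compact_set_def by blast
  have sets: "AE \<omega> in N. averaging_sets (\<lambda>i. Rs i \<omega>) H ?c"
    unfolding H by (rule N.AE_averaging_sets[OF assms(3,4,6,7)])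
  have market: "averaging_market S H ?c \<rho>" if "averaging_sets S H ?c" for S
    using that sublinear_axioms by (rule averaging_market.intro)
  have "\<exists>x. is_arg_min (\<lambda>x. \<sigma> (\<Sum>i<n. x i) (Q\<^sub>0 n \<omega>)) (\<lambda>x. \<forall>i<n. x i \<in> Rs i \<omega>) x"
    if "\<omega> \<in> space N" for n \<omega>
    using direct_cost_attained[of n "\<lambda>i. Rs i \<omega>" "Q\<^sub>0 n \<omega>", OF C[OF that]]
    unfolding is_arg_min_linorder \<sigma> by blast
  moreover have "\<exists>z. is_arg_max (\<lambda>z. H z - z \<bullet> q\<^sub>0) (\<lambda>z. z \<in> polar \<rho>) z"
  proof -
    obtain \<omega> where "averaging_sets (\<lambda>i. Rs i \<omega>) H ?c"
      using eventually_happens'[OF N.ae_filter_bot sets] by blast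
    from averaging_market.dual_maximum[OF market[OF this]] show ?thesis by blast
  qed
  moreover have "AE \<omega> in N. (\<lambda>n. direct_cost \<sigma> n (\<lambda>i. Rs i \<omega>) (Q\<^sub>0 n \<omega>) / real n) \<longlonglongrightarrow> direct_limit \<rho> H q\<^sub>0"
    using sets assms(12) unfolding \<sigma>
    by eventually_elim (rule averaging_market.direct_cost_converges[OF market])
  moreover have "AE \<omega> in N. (\<lambda>n. \<sigma> (\<Sum>i<n. q i p \<omega>) (Q\<^sub>0 n \<omega>) / real n) \<longlonglongrightarrow> \<rho> (gradient H p - q\<^sub>0)"
    if diff: "H differentiable (at p)" for p
    using sets assms(12) AE_space unfolding \<sigma>
  proof eventually_elim
    case (elim \<omega>)
    have q: "q i p \<omega> \<in> Rs i \<omega>" "\<And>y. y \<in> Rs i \<omega> \<Longrightarrow> q i p \<omega> \<bullet> p \<le> y \<bullet> p" for i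
      using assms(13)[OF elim(3), of p i] unfolding is_arg_min_linorder by (auto simp: inner_commute)
    show ?case
      by (rule averaging_market.price_cost_converges[OF market[OF elim(1)] diff q(1) _ elim(2)])
        (use min_support_eqI[OF q] in simp)
  qed
  ultimately show ?thesis by blast
qed

end
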